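(* Let $G$ be the icosahedral group ($G\simeq A_5$) of rotations preserving a regular dodecahedron, or the octahedral group ($G\simeq S_4$) of rotations preserving a cube, where the polyhedron is centred at the origin. For any nonempty finite subset $\alpha\subseteq S$, the stabilizer $\mathcal A_\alpha$ equals $G$ if and only if $\alpha$ is a finite union of certain elements of $$\{V,F,E\}\cup\{B(X)\mid X\in S\setminus(V\cup F\cup E)\}.$$
   Context: $S=\{(x_1,x_2,x_3)\in\mathbb R^3: x_1^2+x_2^2+x_3^2=1\}$ is the Riemann sphere, identified with $\widehat{\mathbb C}=\mathbb C\cup\{\infty\}$ by stereographic projection, so that Möbius transformations ($\mathrm{PSL}(2,\mathbb C)$) act on $S$ and rotations about the origin are Möbius transformations. For $\alpha\subseteq S$, $\mathcal A_\alpha$ is the group of all Möbius transformations $f$ with $f(\alpha)=\alpha$. The dodecahedron (resp. cube) is taken inscribed in $S$. $V\subseteq S$ is its set of vertices, $F\subseteq S$ the set of projections from the origin onto $S$ of the centres of its faces, $E\subseteq S$ the set of projections from the origin onto $S$ of the midpoints of its edges. For $X\in S\setminus(V\cup F\cup E)$, $B(X)$ is the orbit of $X$ under $G$. *)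

theory Defs
  imports "HOL-Analysis.Analysis"
begin

abbreviation riemann_sphere :: "(real^3) set" where
  "riemann_sphere \<equiv> sphere 0 1"

text \<open>The extended complex plane is \<^typ>\<open>complex option\<close>, with \<^term>\<open>None\<close> as the point at
  infinity.\<close>

definition moebius_ext :: "complex \<Rightarrow> complex \<Rightarrow> complex \<Rightarrow> complex
    \<Rightarrow> complex option \<Rightarrow> complex option" where
  "moebius_ext a b c d w = (case w of
      None \<Rightarrow> if c = 0 then None else Some (a / c)
    | Some z \<Rightarrow> if c * z + d = 0 then None else Some (moebius a b c d z))"

text \<open>Stereographic projection from the north pole \<open>(0, 0, 1)\<close>, the only point of
  \<^term>\<open>riemann_sphere\<close> with third coordinate \<open>1\<close>.\<close>

definition stereo :: "real^3 \<Rightarrow> complex option" where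
  "stereo x = (if x$3 = 1 then None else Some (Complex (x$1 / (1 - x$3)) (x$2 / (1 - x$3))))"

lemma bij_betw_stereo: "bij_betw stereo riemann_sphere UNIV"
proof -
  have *: "x \<in> riemann_sphere \<longleftrightarrow> (x$1)\<^sup>2 + (x$2)\<^sup>2 + (x$3)\<^sup>2 = 1" for x :: "real^3"
    by (simp add: norm_vec_def L2_set_def sum_3)
  have "inj_on stereo riemann_sphere"
  proof (rule inj_onI)
    fix x y :: "real^3"
    assume xy: "x \<in> riemann_sphere" "y \<in> riemann_sphere" and eq: "stereo x = stereo y"
    show "x = y"
    proof (cases "x$3 = 1")
      case True
      then have "y$3 = 1" using eq by (auto simp: stereo_def split: if_splits)
      with True xy show ?thesis
        unfolding * by (simp add: vec_eq_iff forall_3 sum_power2_eq_zero_iff)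
    next
      case False
      then have y3: "y$3 \<noteq> 1" using eq by (auto simp: stereo_def split: if_splits)
      define p q where "p = x$1 / (1 - x$3)" and "q = x$2 / (1 - x$3)"
      have x12: "x$1 = p * (1 - x$3)" "x$2 = q * (1 - x$3)" using False by (auto simp: p_def q_def)
      have "p = y$1 / (1 - y$3)" "q = y$2 / (1 - y$3)"
        using eq False y3 by (auto simp: stereo_def p_def q_def)
      then have y12: "y$1 = p * (1 - y$3)" "y$2 = q * (1 - y$3)" using y3 by auto
      have k: "(p\<^sup>2 + q\<^sup>2) * (1 - t) = 1 + t"
        if "(p * (1 - t))\<^sup>2 + (q * (1 - t))\<^sup>2 + t\<^sup>2 = 1" "t \<noteq> 1" for t
      proof -
        have "((p\<^sup>2 + q\<^sup>2) * (1 - t) - (1 + t)) * (1 - t) = 0"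
          using that(1) by (simp add: algebra_simps power2_eq_square)
        then show ?thesis using that(2) by simp
      qed
      have "(p\<^sup>2 + q\<^sup>2) * (1 - x$3) = 1 + x$3"
        using k[of "x$3"] xy(1)[unfolded * x12] False by blast
      moreover have "(p\<^sup>2 + q\<^sup>2) * (1 - y$3) = 1 + y$3"
        using k[of "y$3"] xy(2)[unfolded * y12] y3 by blast
      ultimately have "(p\<^sup>2 + q\<^sup>2 + 1) * (x$3 - y$3) = 0"
        by algebra
      moreover have "p\<^sup>2 + q\<^sup>2 + 1 > 0" by (simp add: add_nonneg_pos)
      ultimately have "x$3 = y$3" by simp
      with x12 y12 show ?thesis by (simp add: vec_eq_iff forall_3)
    qed
  qed
  moreover have "\<exists>x\<in>riemann_sphere. stereo x = w" for w
  proof (cases w)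
    case None
    have "vector [0, 0, 1] \<in> riemann_sphere" unfolding * by simp
    moreover have "stereo (vector [0, 0, 1]) = w" by (simp add: None stereo_def)
    ultimately show ?thesis by blast
  next
    case (Some z)
    define m where "m = (Re z)\<^sup>2 + (Im z)\<^sup>2 + 1"
    define x :: "real^3" where "x = vector [2 * Re z / m, 2 * Im z / m, (m - 2) / m]"
    have m: "m > 0" by (simp add: m_def add_nonneg_pos)
    have "4 * (Re z)\<^sup>2 + 4 * (Im z)\<^sup>2 + (m - 2)\<^sup>2 = m\<^sup>2"
      by (simp add: m_def power2_eq_square algebra_simps)
    then have "x \<in> riemann_sphere" using m unfolding * x_def
      by (simp add: power_divide power_mult_distrib flip: add_divide_distrib)
    moreover have "1 - x$3 = 2 / m" using m by (simp add: x_def field_simps)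
    then have "stereo x = w" using m
      by (auto simp: stereo_def Some x_def complex_eq_iff)
    ultimately show ?thesis by blast
  qed
  ultimately show ?thesis unfolding bij_betw_def by (metis UNIV_eq_I imageI)
qed

text \<open>Transformations of the sphere are elements of \<^term>\<open>extensional riemann_sphere\<close>, so
  that equality of sets of such functions is equality of transformation groups of the sphere.\<close>

definition moebius_group :: "(real^3 \<Rightarrow> real^3) set" where
  "moebius_group =
     {restrict (inv_into riemann_sphere stereo \<circ> moebius_ext a b c d \<circ> stereo) riemann_sphere
      | a b c d. a * d - b * c \<noteq> 0}"

definition moebius_stabilizer :: "(real^3) set \<Rightarrow> (real^3 \<Rightarrow> real^3) set" where
  "moebius_stabilizer \<alpha> = {f \<in> moebius_group. f ` \<alpha> = \<alpha>}"

definition vertices :: "(real^3) set \<Rightarrow> (real^3) set" where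
  "vertices P = {v. v extreme_point_of P}"

definition centre :: "(real^3) set \<Rightarrow> real^3" where
  "centre P = (\<Sum>v\<in>vertices P. v) /\<^sub>R real (card (vertices P))"

definition similarity :: "(real^3 \<Rightarrow> real^3) \<Rightarrow> bool" where
  "similarity s \<longleftrightarrow> (\<exists>f r t. orthogonal_transformation f \<and> r > 0 \<and> s = (\<lambda>x. t + r *\<^sub>R f x))"

definition golden_ratio :: real where
  "golden_ratio = (1 + sqrt 5) / 2"

text \<open>The standard coordinates: the vertices of the cube \<open>[-1, 1]\<^sup>3\<close> and the cyclic permutations
  of \<open>(0, \<plusminus>1/\<phi>, \<plusminus>\<phi>)\<close>.\<close>

definition standard_dodecahedron :: "(real^3) set" where
  "standard_dodecahedron = convex hull
     (let \<phi> = golden_ratio; pm = {-1, 1 :: real} in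
       {vector [a, b, c] | a b c. a \<in> pm \<and> b \<in> pm \<and> c \<in> pm} \<union>
       {vector [0, a / \<phi>, b * \<phi>] | a b. a \<in> pm \<and> b \<in> pm} \<union>
       {vector [a / \<phi>, b * \<phi>, 0] | a b. a \<in> pm \<and> b \<in> pm} \<union>
       {vector [b * \<phi>, 0, a / \<phi>] | a b. a \<in> pm \<and> b \<in> pm})"

definition regular_dodecahedron :: "(real^3) set \<Rightarrow> bool" where
  "regular_dodecahedron P \<longleftrightarrow> (\<exists>s. similarity s \<and> P = s ` standard_dodecahedron)"

definition cube :: "(real^3) set \<Rightarrow> bool" where
  "cube P \<longleftrightarrow> (\<exists>s. similarity s \<and> P = s ` cbox 0 1)"

definition rotation_group :: "(real^3) set \<Rightarrow> (real^3 \<Rightarrow> real^3) set" where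
  "rotation_group P =
     {restrict f riemann_sphere | f. orthogonal_transformation f \<and> det (matrix f) = 1 \<and> f ` P = P}"

text \<open>For nonzero \<^term>\<open>x\<close>, \<^term>\<open>sgn x\<close> is the projection of \<^term>\<open>x\<close> from the origin
  onto \<^term>\<open>riemann_sphere\<close>.\<close>

definition face_points :: "(real^3) set \<Rightarrow> (real^3) set" where
  "face_points P = {sgn (centre Q) | Q. Q facet_of P}"

definition edge_points :: "(real^3) set \<Rightarrow> (real^3) set" where
  "edge_points P = {sgn (midpoint a b) | a b. closed_segment a b edge_of P}"

definition orbit :: "(real^3 \<Rightarrow> real^3) set \<Rightarrow> real^3 \<Rightarrow> (real^3) set" where
  "orbit G X = {g X | g. g \<in> G}"

end

theory Submission
  imports "HOL-Algebra.Group_Action" "HOL-Algebra.Multiplicative_Group" Defs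
begin

text \<open>A finite set \<open>\<alpha>\<close> whose stabilizer is \<open>G\<close> is invariant under \<open>G\<close>, and the sets \<open>V\<close>, \<open>F\<close>, \<open>E\<close>
  and \<open>B X\<close> are orbits of \<open>G\<close>, so \<open>\<alpha>\<close> is the union of those that it contains. Conversely, a union
  \<open>\<alpha>\<close> of such sets is invariant under \<open>G\<close>, so its stabilizer contains \<open>G\<close>; the stabilizer is finite,
  and it remains to see that no finite group of Moebius transformations is properly larger than \<open>G\<close>.

  Maximality comes from the class equation that classically gives the list of finite rotation
  groups. It can be set up for Moebius transformations directly, without conjugating the group into
  the rotations: a Moebius transformation of finite order other than the identity fixes exactly two
  points (\<open>finite_order_moebius_fixed_points\<close>). If a finite group has no orbit of one or two points,
  counting pairs of a nontrivial element and a fixed point of it leaves only the orders 12, 24 and 60,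
  with stabilizer orders \<open>(2, 3, 3)\<close>, \<open>(2, 3, 4)\<close> and \<open>(2, 3, 5)\<close>. An element of order 4 therefore
  forces the order 24, and one of order 5 forces the order 60 (\<open>order_from_element\<close>). The octahedral
  group contains a quarter turn and the icosahedral group a fifth turn, and both contain the
  tetrahedral rotations, which leave no small orbit. Hence \<open>G\<close> and every finite group of Moebius
  transformations that contains \<open>G\<close> have the same order (\<open>moebius_overgroup_order\<close>). That \<open>G\<close> consists of Moebius
  transformations at all is \<open>rotation_sphere_moebius\<close>, proved with Euler angles. A stabilizer is
  finite because three points determine a Moebius transformation, and a nonempty \<open>G\<close>-invariant set
  has at least three points.

  That \<open>V\<close>, \<open>F\<close> and \<open>E\<close> are single orbits is the statement that the rotations act transitively on the
  faces of each dimension (\<open>rotation_transitive_on_faces\<close>). Instead of enumerating the faces of the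
  dodecahedron, the proof uses its reflections. They bound a chamber spanned by a vertex \<open>v\<close>, the
  midpoint \<open>e\<close> of an edge and the centre \<open>f\<close> of a facet. Every point of the polytope can be moved
  into the chamber by a symmetry, and up to symmetry a face is determined by where one of its
  relative interior points ends up: at \<open>v\<close>, on the segment from \<open>v\<close> to \<open>e\<close>, or elsewhere on the triangle \<open>v e f\<close>.
  The orientation can be corrected with a reflection that preserves the face. For a concrete polytope
  only three reflections and a handful of incidences have to be checked.\<close>

hide_const (open) Polynomial.order
hide_fact (open) Polynomial.order_def

section \<open>Class equation for groups whose elements have two fixed points\<close>

text \<open>With three orbits the class equation reads \<open>1/r1 + 1/r2 + 1/r3 = 1 + 2/N\<close>. As no orbit has fewer
  than three points, this leaves only the stabilizer orders \<open>(2, 3, 3)\<close>, \<open>(2, 3, 4)\<close> and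
  \<open>(2, 3, 5)\<close>, and a stabilizer order divisible by 4 or by 5 singles out one of them.\<close>

lemma three_orbit_sizes:
  fixes N o1 o2 o3 r1 r2 r3 :: nat
  assumes N: "o1 * r1 = N" "o2 * r2 = N" "o3 * r3 = N"
    and sum: "N + 2 = o1 + o2 + o3"
    and r: "r2 \<ge> 2" "r3 \<ge> 2" and os: "o1 \<ge> 3" "o2 \<ge> 3" "o3 \<ge> 3"
    and r1: "m dvd r1" "m = 4 \<or> m = 5" "r1 > 0"
  shows "m = 4 \<and> N = 24 \<or> m = 5 \<and> N = 60"
proof -
  \<comment> \<open>The other two stabilizer orders enter symmetrically; \<open>p\<close> is the smaller one.\<close>
  have main: "m = 4 \<and> N = 24 \<or> m = 5 \<and> N = 60"
    if N: "p * a = N" "q * b = N" and pq: "p \<le> q" "p \<ge> 2" "N + 2 = o1 + a + b" and ab: "a \<ge> 3" "b \<ge> 3"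
    for p q a b :: nat
  proof -
    have r4: "r1 \<ge> 4" using r1 by (auto dest!: dvd_imp_le)
    \<comment> \<open>The first orbit is at most a quarter of the group, so the other two make up at least three quarters
      of the sum.\<close>
    have o1: "4 * o1 \<le> N" using r4 assms(1) by (metis mult.commute mult_le_mono1)
    have p2: "p = 2"
    proof (rule ccontr)
      assume "p \<noteq> 2"
      then have "p \<ge> 3" "q \<ge> 3" using pq by auto
      then have "3 * a \<le> N" "3 * b \<le> N" using N by (metis mult_le_mono1)+
      with o1 pq show False by linarith
    qed
    have a: "2 * a = N" using p2 N by simp
    have q3: "q = 3"
    proof (rule ccontr)
      assume "q \<noteq> 3"
      then consider "q = 2" | "q \<ge> 4" using pq p2 by linarith
      then show False
      proof cases
        case 1
        then have "2 * b = N" using N by simp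
        with a pq os show False by linarith
      next
        case 2
        then have "4 * b \<le> N" using N by (metis mult_le_mono1)
        with a pq o1 show False by linarith
      qed
    qed
    have b: "3 * b = N" using q3 N by simp
    have o6: "6 * o1 = N + 12" using a b pq by linarith
    have "r1 < 6"
    proof (rule ccontr)
      assume "\<not> r1 < 6"
      then have "6 * o1 \<le> N" using assms(1) by (metis linorder_not_less mult.commute mult_le_mono1)
      then show False using o6 by linarith
    qed
    with r4 have "r1 = 4 \<or> r1 = 5" by linarith
    with r1(1,2) have "r1 = m" by auto
    with assms(1) o6 r1(2) show ?thesis by auto
  qed
  show ?thesis
  proof (cases "r2 \<le> r3")
    case True
    then show ?thesis using main[of r2 o2 r3 o3] assms by (simp add: mult.commute)
  next
    case False
    then show ?thesis using main[of r3 o3 r2 o2] assms by (simp add: mult.commute)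
  qed
qed

text \<open>The action of a finite group of rotations or Moebius transformations on the sphere, apart from the
  cyclic and dihedral groups, which have an orbit of at most two points.\<close>

locale rotation_like_action = group_action +
  assumes finite_carrier: "finite (carrier G)"
    and nonempty: "E \<noteq> {}"
    and two_fixed_points: "\<And>g. g \<in> carrier G \<Longrightarrow> g \<noteq> \<one> \<Longrightarrow> card (invariants E \<phi> g) = 2"
    and large_orbits: "\<And>x. x \<in> E \<Longrightarrow> 3 \<le> card (Group_Action.orbit G \<phi> x)"
begin

sublocale group G
  using group_hom by (rule group_hom.axioms)

abbreviation stab :: "'c \<Rightarrow> nat" where
  "stab x \<equiv> card (stabilizer G \<phi> x)"

definition poles :: "'c set" where
  "poles = {x \<in> E. 2 \<le> stab x}"

definition pole_orbits :: "'c set set" where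
  "pole_orbits = Group_Action.orbit G \<phi> ` poles"

lemma finite_stabilizer: "finite (stabilizer G \<phi> x)"
  using finite_carrier by (simp add: stabilizer_def)

lemma stab_pos: "x \<in> E \<Longrightarrow> 0 < stab x"
  using stabilizer_one_closed finite_stabilizer by (auto simp: card_gt_0_iff)

lemma stab_eq: "x \<in> E \<Longrightarrow> stab x = Suc (card {g \<in> carrier G - {\<one>}. \<phi> g x = x})"
proof -
  assume x: "x \<in> E"
  have "stabilizer G \<phi> x = insert \<one> {g \<in> carrier G - {\<one>}. \<phi> g x = x}"
    using stabilizer_one_closed[OF x] by (auto simp: stabilizer_def)
  then show ?thesis using finite_carrier by simp
qed

lemma pole_iff: "x \<in> poles \<longleftrightarrow> x \<in> E \<and> (\<exists>g \<in> carrier G - {\<one>}. \<phi> g x = x)"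
proof (cases "x \<in> E")
  case True
  have "2 \<le> stab x \<longleftrightarrow> 0 < card {g \<in> carrier G - {\<one>}. \<phi> g x = x}"
    unfolding stab_eq[OF True] by auto
  also have "\<dots> \<longleftrightarrow> (\<exists>g \<in> carrier G - {\<one>}. \<phi> g x = x)"
    using finite_carrier by (auto simp: card_gt_0_iff)
  finally show ?thesis using True by (simp add: poles_def)
qed (simp add: poles_def)

lemma finite_poles: "finite poles"
proof (rule finite_subset)
  show "poles \<subseteq> (\<Union>g\<in>carrier G - {\<one>}. invariants E \<phi> g)"
    by (auto simp: pole_iff invariants_def)
  show "finite (\<Union>g\<in>carrier G - {\<one>}. invariants E \<phi> g)"
    using finite_carrier two_fixed_points by (intro finite_UN_I) (auto intro!: card_ge_0_finite)
qed

text \<open>The pairs \<open>(g, x)\<close> with \<open>g \<noteq> \<one>\<close> and \<open>g x = x\<close> are counted twice: every \<open>g\<close> contributes its two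
  fixed points, and every pole contributes the nontrivial elements of its stabilizer.\<close>

lemma sum_stab_poles: "(\<Sum>x\<in>poles. stab x) + 2 = 2 * order G + card poles"
proof -
  have two: "card {x \<in> poles. \<phi> g x = x} = 2" if "g \<in> carrier G - {\<one>}" for g
  proof -
    have "{x \<in> poles. \<phi> g x = x} = invariants E \<phi> g"
      using that unfolding invariants_def pole_iff by blast
    then show ?thesis using two_fixed_points that by simp
  qed
  have "(\<Sum>x\<in>poles. card {g \<in> carrier G - {\<one>}. \<phi> g x = x}) = (\<Sum>g\<in>carrier G - {\<one>}. 2)"
    using finite_poles finite_carrier two by (intro sum_multicount_gen) auto
  also have "\<dots> = 2 * (order G - 1)"
    using finite_carrier by (simp add: order_def)
  finally have "(\<Sum>x\<in>poles. card {g \<in> carrier G - {\<one>}. \<phi> g x = x}) = 2 * (order G - 1)" .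
  moreover have "(\<Sum>x\<in>poles. stab x)
      = (\<Sum>x\<in>poles. Suc (card {g \<in> carrier G - {\<one>}. \<phi> g x = x}))"
    by (rule sum.cong) (auto simp: poles_def stab_eq)
  ultimately have "(\<Sum>x\<in>poles. stab x) = card poles + 2 * (order G - 1)"
    by (simp add: sum_Suc)
  moreover have "order G > 0"
    using finite_carrier by (auto simp: order_def card_gt_0_iff)
  ultimately show ?thesis by linarith
qed

lemma stab_orbit:
  assumes "x \<in> E" "y \<in> Group_Action.orbit G \<phi> x"
  shows "y \<in> E" "stab y = stab x"
proof -
  show y: "y \<in> E" using assms element_image by (auto simp: Group_Action.orbit_def)
  have "Group_Action.orbit G \<phi> a \<subseteq> Group_Action.orbit G \<phi> b"
    if "a \<in> E" "b \<in> E" "a \<in> Group_Action.orbit G \<phi> b" for a b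
  proof
    fix z assume z: "z \<in> Group_Action.orbit G \<phi> a"
    then have "z \<in> E" using that(1) element_image unfolding Group_Action.orbit_def by blast
    then show "z \<in> Group_Action.orbit G \<phi> b" using orbit_trans that z by blast
  qed
  then have "Group_Action.orbit G \<phi> y = Group_Action.orbit G \<phi> x"
    using assms y orbit_sym[OF assms(1) y assms(2)] by blast
  then have "card (Group_Action.orbit G \<phi> x) * stab y = card (Group_Action.orbit G \<phi> x) * stab x"
    using orbit_stabilizer_theorem[OF assms(1)] orbit_stabilizer_theorem[OF y] by simp
  then show "stab y = stab x" using large_orbits[OF assms(1)] by simp
qed

lemma pole_orbits_subset: "pole_orbits \<subseteq> orbits G E \<phi>"
  by (auto simp: pole_orbits_def orbits_def poles_def)

lemma Union_pole_orbits: "\<Union> pole_orbits = poles"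
proof -
  have "y \<in> poles" if "x \<in> poles" "y \<in> Group_Action.orbit G \<phi> x" for x y
    using that stab_orbit by (auto simp: poles_def)
  moreover have "x \<in> Group_Action.orbit G \<phi> x" if "x \<in> poles" for x
    using that orbit_refl by (simp add: poles_def)
  ultimately show ?thesis unfolding pole_orbits_def by blast
qed

lemma sum_pole_orbits: "(\<Sum>C\<in>pole_orbits. sum h C) = sum h poles"
proof -
  have "sum h (\<Union> pole_orbits) = (\<Sum>C\<in>pole_orbits. sum h C)"
  proof (subst sum.Union_disjoint)
    show "\<forall>A\<in>pole_orbits. finite A"
      using finite_poles Union_pole_orbits by (metis Union_upper finite_subset)
    show "\<forall>A\<in>pole_orbits. \<forall>B\<in>pole_orbits. A \<noteq> B \<longrightarrow> A \<inter> B = {}"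
      using disjoint_union pole_orbits_subset by blast
  qed simp
  then show ?thesis by (simp add: Union_pole_orbits)
qed

text \<open>The stabilizer orders along one orbit add up to the order of the group, which turns the count over
  poles into a count over orbits.\<close>

lemma class_equation: "card pole_orbits * order G + 2 = 2 * order G + (\<Sum>C\<in>pole_orbits. card C)"
proof -
  have "(\<Sum>x\<in>poles. stab x) = (\<Sum>C\<in>pole_orbits. order G)"
    unfolding sum_pole_orbits[symmetric]
    using pole_orbits_subset finite_carrier by (intro sum.cong refl card_stablizer_sum) auto
  moreover have "card poles = (\<Sum>C\<in>pole_orbits. card C)"
    using sum_pole_orbits[of "\<lambda>_. 1::nat"] by simp
  ultimately show ?thesis using sum_stab_poles by simp
qed

lemma pole_orbit_size:
  assumes "C \<in> pole_orbits"
  obtains r where "card C * r = order G" "2 \<le> r" "3 \<le> card C"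
  using assms orbit_stabilizer_theorem large_orbits by (auto simp: pole_orbits_def poles_def)

text \<open>An orbit of poles has at least 3 and at most \<open>N / 2\<close> points, where \<open>N\<close> is the order of the group.
  Inserting the lower bound into the class equation excludes fewer than three orbits, inserting the
  upper bound excludes more.\<close>

lemma card_pole_orbits: "card pole_orbits = 3"
proof -
  let ?k = "card pole_orbits" and ?s = "\<Sum>C\<in>pole_orbits. card C"
  have fin: "finite pole_orbits" by (simp add: pole_orbits_def finite_poles)
  have "3 \<le> card C" if "C \<in> pole_orbits" for C
    using that pole_orbit_size by blast
  then have lower: "?k * 3 \<le> ?s"
    using sum_mono[of pole_orbits "\<lambda>_. 3" card] by simp
  have "2 * card C \<le> order G" if "C \<in> pole_orbits" for C
  proof -
    obtain r where "card C * r = order G" "2 \<le> r" using pole_orbit_size \<open>C \<in> pole_orbits\<close> by blast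
    then show ?thesis using mult_le_mono2[of 2 r "card C"] by (simp add: mult.commute)
  qed
  then have upper: "2 * ?s \<le> ?k * order G"
    using sum_mono[of pole_orbits "\<lambda>C. 2 * card C" "\<lambda>_. order G"] by (simp add: sum_distrib_left)
  have "?k \<noteq> 0"
  proof
    assume "?k = 0"
    then have "order G = 1" using class_equation fin by simp
    moreover obtain x where "x \<in> E" using nonempty by blast
    ultimately show False
      using orbit_stabilizer_theorem[of x] large_orbits[of x] by simp
  qed
  moreover have "?k \<noteq> 1" using class_equation lower by (intro notI) simp
  moreover have "?k \<noteq> 2" using class_equation lower by (intro notI) simp
  moreover have "\<not> 4 \<le> ?k"
  proof
    assume k: "4 \<le> ?k"
    have "2 * (?k * order G) + 4 = 4 * order G + 2 * ?s" using class_equation by simp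
    with upper have "?k * order G + 4 \<le> 4 * order G" by linarith
    moreover have "4 * order G \<le> ?k * order G" using k by simp
    ultimately show False by linarith
  qed
  ultimately show ?thesis by linarith
qed

theorem order_from_stabilizer:
  assumes x: "x \<in> E" and m: "m dvd stab x" "m = 4 \<or> m = 5"
  shows "m = 4 \<and> order G = 24 \<or> m = 5 \<and> order G = 60"
proof -
  define o1 where "o1 = Group_Action.orbit G \<phi> x"
  have "m \<le> stab x" using m stab_pos[OF x] by (simp add: dvd_imp_le)
  then have "x \<in> poles" using m x by (auto simp: poles_def)
  then have o1: "o1 \<in> pole_orbits" by (simp add: o1_def pole_orbits_def)
  have "card (pole_orbits - {o1}) = 2"
    using o1 card_pole_orbits by (simp add: card_Diff_singleton_if)
  then obtain o2 o3 where o23: "pole_orbits - {o1} = {o2, o3}" "o2 \<noteq> o3" by (auto simp: card_2_iff)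
  then have os: "pole_orbits = {o1, o2, o3}" "o1 \<noteq> o2" "o1 \<noteq> o3" using o1 by auto
  obtain r2 where r2: "card o2 * r2 = order G" "2 \<le> r2" "3 \<le> card o2"
    using pole_orbit_size os by blast
  obtain r3 where r3: "card o3 * r3 = order G" "2 \<le> r3" "3 \<le> card o3"
    using pole_orbit_size os by blast
  have "order G + 2 = card o1 + card o2 + card o3"
    using class_equation card_pole_orbits os o23(2) by simp
  moreover have "card o1 * stab x = order G" "3 \<le> card o1"
    using orbit_stabilizer_theorem[OF x] large_orbits[OF x] by (auto simp: o1_def)
  ultimately show ?thesis
    using three_orbit_sizes r2 r3 m stab_pos[OF x] by blast
qed

text \<open>The order of \<open>g\<close> divides the stabilizer order of a fixed point of \<open>g\<close>, by Lagrange's theorem.\<close>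

theorem order_from_element:
  assumes g: "g \<in> carrier G" "g \<noteq> \<one>" and m: "ord g = m" "m = 4 \<or> m = 5"
  shows "m = 4 \<and> order G = 24 \<or> m = 5 \<and> order G = 60"
proof -
  have "invariants E \<phi> g \<noteq> {}"
    using two_fixed_points[OF g] by auto
  then obtain x where x: "x \<in> E" "\<phi> g x = x"
    by (auto simp: invariants_def)
  let ?H = "stabilizer G \<phi> x"
  have sub: "subgroup ?H G" using stabilizer_subgroup x by simp
  interpret H: group "G\<lparr>carrier := ?H\<rparr>"
    using sub by (rule subgroup_imp_group)
  have gH: "g \<in> ?H" using g x by (simp add: stabilizer_def)
  then have "H.ord g dvd order (G\<lparr>carrier := ?H\<rparr>)"
    by (intro H.ord_dvd_group_order) simp
  moreover have "H.ord g = ord g"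
    unfolding H.ord_def ord_def nat_pow_def by simp
  ultimately have "m dvd stab x" using m by (simp add: order_def)
  with x m show ?thesis by (intro order_from_stabilizer)
qed

end

section \<open>Fixed points of Moebius maps of the extended plane\<close>

unbundle no m_inv_syntax

definition is_moebius :: "(complex option \<Rightarrow> complex option) \<Rightarrow> bool" where
  "is_moebius f \<longleftrightarrow> (\<exists>a b c d. a * d - b * c \<noteq> 0 \<and> f = moebius_ext a b c d)"

text \<open>Composition multiplies the coefficient matrices, also where infinity is an argument, an
  intermediate value or the result.\<close>

lemma moebius_ext_comp:
  assumes "a * d - b * c \<noteq> 0" "a' * d' - b' * c' \<noteq> 0"
  shows "moebius_ext a b c d (moebius_ext a' b' c' d' w)
    = moebius_ext (a * a' + b * c') (a * b' + b * d') (c * a' + d * c') (c * b' + d * d') w"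
proof (cases w)
  case None
  show ?thesis
  proof (cases "c' = 0")
    case True
    with assms have "a' \<noteq> 0" by auto
    with True None show ?thesis by (simp add: moebius_ext_def)
  next
    case False
    have "c * (a' / c') + d = (c * a' + d * c') / c'" using False by (simp add: field_simps)
    moreover have "a * (a' / c') + b = (a * a' + b * c') / c'" using False by (simp add: field_simps)
    ultimately show ?thesis using False None by (simp add: moebius_ext_def moebius_def)
  qed
next
  case (Some z)
  have num: "(a * a' + b * c') * z + (a * b' + b * d') = a * (a' * z + b') + b * (c' * z + d')"
    and den: "(c * a' + d * c') * z + (c * b' + d * d') = c * (a' * z + b') + d * (c' * z + d')"
    by (simp_all add: algebra_simps)
  show ?thesis
  proof (cases "c' * z + d' = 0")
    case True
    have "a' * z + b' \<noteq> 0"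
    proof
      assume "a' * z + b' = 0"
      moreover have "a' * d' - b' * c' = a' * (c' * z + d') - c' * (a' * z + b')"
        by (simp add: algebra_simps)
      ultimately show False using assms True by simp
    qed
    with True Some show ?thesis
      by (simp add: moebius_ext_def moebius_def num den)
  next
    case False
    let ?n = "a' * z + b'" and ?e = "c' * z + d'"
    have "c * (?n / ?e) + d = (c * ?n + d * ?e) / ?e" "a * (?n / ?e) + b = (a * ?n + b * ?e) / ?e"
      using False by (simp_all add: field_simps)
    with False Some show ?thesis
      by (simp add: moebius_ext_def moebius_def num den)
  qed
qed

lemma is_moebius_comp:
  assumes "is_moebius f" "is_moebius g"
  shows "is_moebius (f \<circ> g)"
proof -
  obtain a b c d where f: "a * d - b * c \<noteq> 0" "f = moebius_ext a b c d"
    using assms by (auto simp: is_moebius_def)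
  obtain a' b' c' d' where g: "a' * d' - b' * c' \<noteq> 0" "g = moebius_ext a' b' c' d'"
    using assms by (auto simp: is_moebius_def)
  have "(a * a' + b * c') * (c * b' + d * d') - (a * b' + b * d') * (c * a' + d * c')
      = (a * d - b * c) * (a' * d' - b' * c')"
    by (simp add: algebra_simps)
  moreover have "f \<circ> g
      = moebius_ext (a * a' + b * c') (a * b' + b * d') (c * a' + d * c') (c * b' + d * d')"
    using f g by (auto simp: moebius_ext_comp)
  ultimately show ?thesis using f g unfolding is_moebius_def by (metis mult_eq_0_iff)
qed

lemma moebius_ext_scalar: "a \<noteq> 0 \<Longrightarrow> moebius_ext a 0 0 a = id"
  by (auto simp: moebius_ext_def moebius_def split: option.splits)

lemma is_moebius_id: "is_moebius id"
  unfolding is_moebius_def using moebius_ext_scalar[of 1] by (metis diff_zero mult_zero_right one_neq_zero mult.right_neutral)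

lemma is_moebius_inverse:
  assumes "is_moebius f"
  obtains g where "is_moebius g" "f \<circ> g = id" "g \<circ> f = id"
proof -
  obtain a b c d where f: "a * d - b * c \<noteq> 0" "f = moebius_ext a b c d"
    using assms by (auto simp: is_moebius_def)
  define g where "g = moebius_ext d (-b) (-c) a"
  have det: "d * a - (-b) * (-c) \<noteq> 0" using f by (simp add: mult.commute)
  have "f \<circ> g = moebius_ext (a * d - b * c) 0 0 (a * d - b * c)"
    "g \<circ> f = moebius_ext (a * d - b * c) 0 0 (a * d - b * c)"
    using moebius_ext_comp[OF f(1) det] moebius_ext_comp[OF det f(1)] f
    by (auto simp: g_def fun_eq_iff algebra_simps)
  then have "f \<circ> g = id" "g \<circ> f = id" using moebius_ext_scalar f(1) by auto
  moreover have "is_moebius g" using det unfolding is_moebius_def g_def by blast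
  ultimately show thesis using that by blast
qed

lemma is_moebius_bij: "is_moebius f \<Longrightarrow> bij f"
  by (metis is_moebius_inverse o_bij)

text \<open>Infinity is fixed if \<open>c = 0\<close>; otherwise the fixed points are the roots of
  \<open>c z\<^sup>2 + (d - a) z - b\<close>.\<close>

lemma is_moebius_fixed_point:
  assumes "is_moebius f"
  obtains p where "f p = p"
proof -
  obtain a b c d where f: "a * d - b * c \<noteq> 0" "f = moebius_ext a b c d"
    using assms by (auto simp: is_moebius_def)
  show thesis
  proof (cases "c = 0")
    case True
    then show thesis using that[of None] f by (simp add: moebius_ext_def)
  next
    case False
    define s where "s = csqrt ((d - a)\<^sup>2 + 4 * c * b)"
    define z where "z = (a - d + s) / (2 * c)"
    have z: "2 * c * z = a - d + s" using False by (simp add: z_def)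
    have "s\<^sup>2 = (d - a)\<^sup>2 + 4 * c * b" by (simp add: s_def)
    moreover have "4 * c * (c * z\<^sup>2 + d * z - a * z - b)
        = (2 * c * z)\<^sup>2 + 2 * (d - a) * (2 * c * z) - 4 * c * b"
      by (simp add: algebra_simps power2_eq_square)
    ultimately have "4 * c * (c * z\<^sup>2 + d * z - a * z - b) = 0"
      unfolding z by (simp add: algebra_simps power2_eq_square)
    with False have "c * z\<^sup>2 + d * z - a * z - b = 0" by simp
    then have eq: "a * z + b = z * (c * z + d)"
      by (simp add: algebra_simps power2_eq_square)
    have "c * z + d \<noteq> 0"
    proof
      assume "c * z + d = 0"
      moreover from this eq have "a * z + b = 0" by simp
      moreover have "a * d - b * c = a * (c * z + d) - c * (a * z + b)"
        by (simp add: algebra_simps)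
      ultimately show False using f by simp
    qed
    with eq have "f (Some z) = Some z" by (simp add: f moebius_ext_def moebius_def)
    then show thesis by (rule that)
  qed
qed

lemma moebius_to_infinity:
  obtains h where "is_moebius h" "h p = None"
proof (cases p)
  case None
  then show thesis using that[of id] is_moebius_id by simp
next
  case (Some z)
  have "is_moebius (moebius_ext 0 1 1 (-z))"
    unfolding is_moebius_def by (intro exI[of _ 0] exI[of _ 1] exI[of _ "-z"]) auto
  moreover have "moebius_ext 0 1 1 (-z) p = None" by (simp add: Some moebius_ext_def)
  ultimately show thesis using that by blast
qed

lemma is_moebius_fixing_infinity:
  assumes "is_moebius f" "f None = None"
  obtains u v where "u \<noteq> 0" "\<And>z. f (Some z) = Some (u * z + v)"
proof -
  obtain a b c d where f: "a * d - b * c \<noteq> 0" "f = moebius_ext a b c d"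
    using assms by (auto simp: is_moebius_def)
  have c: "c = 0" using assms f by (auto simp: moebius_ext_def split: if_splits)
  with f have "a \<noteq> 0" "d \<noteq> 0" by auto
  then show thesis
    using that[of "a / d" "b / d"] f c by (simp add: moebius_ext_def moebius_def add_divide_distrib)
qed

text \<open>A Moebius map fixing infinity is affine. If its linear coefficient were 1 it would be a translation,
  which has infinite order; hence there is exactly one finite fixed point.\<close>

lemma fixing_infinity_fixed_points:
  assumes f: "is_moebius f" "f None = None" "f \<noteq> id" and fin: "(f ^^ n) = id" "n > 0"
  shows "card {x. f x = x} = 2"
proof -
  obtain u v where uv: "u \<noteq> 0" "\<And>z. f (Some z) = Some (u * z + v)"
    using is_moebius_fixing_infinity[OF f(1,2)] by blast
  have "u \<noteq> 1"
  proof
    assume "u = 1"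
    have "(f ^^ k) (Some 0) = Some (of_nat k * v)" for k
      by (induction k) (auto simp: uv \<open>u = 1\<close> algebra_simps)
    from this[of n] fin have "v = 0" by simp
    with f uv \<open>u = 1\<close> have "f x = x" for x by (cases x) auto
    with f show False by auto
  qed
  then have iff: "f x = x \<longleftrightarrow> x \<in> {None, Some (v / (1 - u))}" for x
    using f uv by (cases x) (auto simp: field_simps)
  have "{x. f x = x} = {None, Some (v / (1 - u))}"
    by (simp only: iff Collect_mem_eq)
  then show ?thesis by simp
qed

lemma conjugate_fixed_points:
  assumes "bij h"
  shows "{x. (h \<circ> f \<circ> inv h) x = x} = h ` {x. f x = x}"
proof -
  have "h (f (inv h x)) = x \<longleftrightarrow> f (inv h x) = inv h x" for x
    using assms by (metis bij_inv_eq_iff)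
  then have "{x. (h \<circ> f \<circ> inv h) x = x} = inv h -` {x. f x = x}" by auto
  then show ?thesis using assms by (simp add: bij_image_Collect_eq vimage_def)
qed

lemma conjugate_funpow:
  assumes "bij h"
  shows "(h \<circ> f \<circ> inv h) ^^ n = h \<circ> (f ^^ n) \<circ> inv h"
proof (induction n)
  case 0
  have "h (inv h x) = x" for x using assms by (simp add: bij_is_surj surj_f_inv_f)
  then show ?case by (simp add: fun_eq_iff)
next
  case (Suc n)
  have "inv h (h x) = x" for x using assms by (simp add: bij_is_inj)
  then have "(h \<circ> f \<circ> inv h) \<circ> (h \<circ> (f ^^ n) \<circ> inv h) = h \<circ> (f \<circ> (f ^^ n)) \<circ> inv h"
    by (simp add: fun_eq_iff)
  then show ?case by (simp only: funpow.simps Suc)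
qed

lemma is_moebius_inv: "is_moebius h \<Longrightarrow> is_moebius (inv h)"
  by (metis is_moebius_inverse inv_unique_comp)

lemma conjugate_to_fix_infinity:
  assumes f: "is_moebius f" "f p = p"
  obtains h where "bij h" "is_moebius (h \<circ> f \<circ> inv h)" "(h \<circ> f \<circ> inv h) None = None"
proof -
  obtain h where h: "is_moebius h" "h p = None" using moebius_to_infinity by blast
  then have b: "bij h" by (simp add: is_moebius_bij)
  then have "inv h None = p" using h by (metis bij_inv_eq_iff)
  then show thesis using that[of h] b f h is_moebius_comp is_moebius_inv by simp
qed

lemma conjugate_eq_id:
  assumes "bij h"
  shows "h \<circ> f \<circ> inv h = id \<longleftrightarrow> f = id"
proof
  assume eq: "h \<circ> f \<circ> inv h = id"
  have "f x = x" for x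
    using fun_cong[OF eq, of "h x"] assms by (simp add: bij_is_inj inj_eq)
  then show "f = id" by auto
next
  assume "f = id"
  then show "h \<circ> f \<circ> inv h = id" using assms by (simp add: fun_eq_iff bij_is_surj surj_f_inv_f)
qed

text \<open>Conjugation moves one fixed point to infinity and so reduces the claim to affine maps.\<close>

theorem finite_order_moebius_fixed_points:
  assumes f: "is_moebius f" "f \<noteq> id" and fin: "(f ^^ n) = id" "n > 0"
  shows "card {x. f x = x} = 2"
proof -
  obtain p where "f p = p" using is_moebius_fixed_point[OF f(1)] by blast
  then obtain h where h: "bij h" "is_moebius (h \<circ> f \<circ> inv h)" "(h \<circ> f \<circ> inv h) None = None"
    using conjugate_to_fix_infinity f by blast
  have "card {x. (h \<circ> f \<circ> inv h) x = x} = 2"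
  proof (rule fixing_infinity_fixed_points)
    show "h \<circ> f \<circ> inv h \<noteq> id" using f h conjugate_eq_id by blast
    show "(h \<circ> f \<circ> inv h) ^^ n = id" 
      using conjugate_eq_id[OF h(1), of id] h(1) fin by (simp only: conjugate_funpow)
    show "is_moebius (h \<circ> f \<circ> inv h)" "(h \<circ> f \<circ> inv h) None = None" "n > 0" by fact+
  qed
  then show ?thesis
    using h(1) by (simp only: conjugate_fixed_points card_image[OF inj_on_subset[OF bij_is_inj[OF h(1)] subset_UNIV]])
qed

text \<open>If one of the fixed points is moved to infinity, the map becomes affine with two finite fixed
  points.\<close>

theorem moebius_three_fixed_points:
  assumes f: "is_moebius f" and A: "3 \<le> card A" "\<And>x. x \<in> A \<Longrightarrow> f x = x"
  shows "f = id"
proof -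
  have "A \<noteq> {}" using A(1) by auto
  then obtain p where p: "p \<in> A" by blast
  then have "f p = p" by (rule A(2))
  then obtain h where h: "bij h" "is_moebius (h \<circ> f \<circ> inv h)" "(h \<circ> f \<circ> inv h) None = None"
    using conjugate_to_fix_infinity[OF f] by blast
  let ?g = "h \<circ> f \<circ> inv h"
  obtain u v where uv: "u \<noteq> 0" "\<And>z. ?g (Some z) = Some (u * z + v)"
    using is_moebius_fixing_infinity[OF h(2,3)] by blast
  have card: "3 \<le> card (h ` A)" using A h by (metis bij_is_inj card_image inj_on_subset subset_UNIV)
  have fixed: "?g x = x" if "x \<in> h ` A" for x
    using that A h by (auto simp: bij_is_inj)
  obtain y z where yz: "y \<noteq> z" "Some y \<in> h ` A" "Some z \<in> h ` A"
  proof -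
    have "2 \<le> card (h ` A - {None})" using card
      by (cases "None \<in> h ` A") (simp_all add: card_Diff_singleton_if del: card_image)
    then obtain B where "B \<subseteq> h ` A - {None}" "card B = 2" by (meson obtain_subset_with_card_n)
    then obtain y z where "y \<noteq> z" "y \<in> h ` A - {None}" "z \<in> h ` A - {None}" by (auto simp: card_2_iff)
    then show thesis using that by (metis Diff_iff insertI1 not_None_eq)
  qed
  have "Some (u * y + v) = Some y" "Some (u * z + v) = Some z"
    using fixed[OF yz(2)] fixed[OF yz(3)] by (simp_all only: uv(2))
  then have "u * y + v = y" "u * z + v = z" by simp_all
  moreover have "(u - 1) * (y - z) = (u * y + v - y) - (u * z + v - z)"
    by (simp add: algebra_simps)
  ultimately have "(u - 1) * (y - z) = 0" by simp
  with yz have "u = 1" by simp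
  with \<open>u * y + v = y\<close> have "v = 0" by simp
  have "?g x = x" for x
    using uv(2) h(3) by (cases x) (simp_all only: \<open>u = 1\<close> \<open>v = 0\<close> mult_1 add_0_right)
  then have "?g = id" by (simp only: fun_eq_iff id_apply simp_thms)
  then show ?thesis using conjugate_eq_id h by blast
qed

section \<open>Moebius maps of the sphere\<close>

text \<open>Only the values on the sphere matter here, so that the notion applies to linear maps of the
  surrounding space as well as to elements of \<^const>\<open>extensional\<close>.\<close>

definition sphere_moebius :: "(real^3 \<Rightarrow> real^3) \<Rightarrow> bool" where
  "sphere_moebius f \<longleftrightarrow>
    (\<exists>m. is_moebius m \<and> (\<forall>x\<in>riemann_sphere. f x \<in> riemann_sphere \<and> stereo (f x) = m (stereo x)))"

lemma stereo_eq_iff: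
  "x \<in> riemann_sphere \<Longrightarrow> y \<in> riemann_sphere \<Longrightarrow> stereo x = stereo y \<longleftrightarrow> x = y"
  using bij_betw_stereo by (auto simp: bij_betw_def inj_on_eq_iff)

lemma stereo_surj: obtains x where "x \<in> riemann_sphere" "stereo x = w"
  using bij_betw_stereo by (metis UNIV_I bij_betw_def imageE)

text \<open>A commuting square with \<^const>\<open>stereo\<close> is easier to compose and to invert than a formula that
  involves the inverse of \<^const>\<open>stereo\<close>.\<close>

lemma moebius_group_iff:
  "f \<in> moebius_group \<longleftrightarrow> f \<in> extensional riemann_sphere \<and> sphere_moebius f"
proof
  let ?inv = "inv_into riemann_sphere stereo"
  have inv: "?inv w \<in> riemann_sphere" "stereo (?inv w) = w" for w
    using bij_betw_stereo unfolding bij_betw_def by (metis UNIV_I inv_into_into, metis UNIV_I f_inv_into_f)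
  {
    assume "f \<in> moebius_group"
    then obtain a b c d where f: "a * d - b * c \<noteq> 0"
      "f = restrict (?inv \<circ> moebius_ext a b c d \<circ> stereo) riemann_sphere"
      by (auto simp: moebius_group_def)
    then have "is_moebius (moebius_ext a b c d)" unfolding is_moebius_def by blast
    then show "f \<in> extensional riemann_sphere \<and> sphere_moebius f"
      unfolding sphere_moebius_def using f inv by (intro conjI exI[of _ "moebius_ext a b c d"]) auto
  next
    assume f: "f \<in> extensional riemann_sphere \<and> sphere_moebius f"
    then obtain a b c d where m: "a * d - b * c \<noteq> 0"
      "\<And>x. x \<in> riemann_sphere \<Longrightarrow> f x \<in> riemann_sphere \<and> stereo (f x) = moebius_ext a b c d (stereo x)"
      unfolding sphere_moebius_def is_moebius_def by blast
    have "f = restrict (?inv \<circ> moebius_ext a b c d \<circ> stereo) riemann_sphere"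
    proof (rule extensionalityI)
      show "f x = restrict (?inv \<circ> moebius_ext a b c d \<circ> stereo) riemann_sphere x"
        if "x \<in> riemann_sphere" for x
        using m(2)[OF that] inv that stereo_eq_iff[of "f x" "?inv (stereo (f x))"] by simp
    qed (use f in auto)
    then show "f \<in> moebius_group" using m(1) unfolding moebius_group_def by blast
  }
qed

lemma restrict_in_moebius_group: "sphere_moebius f \<Longrightarrow> restrict f riemann_sphere \<in> moebius_group"
  by (simp add: moebius_group_iff sphere_moebius_def)

lemma sphere_moebius_comp:
  assumes "sphere_moebius f" "sphere_moebius g"
  shows "sphere_moebius (f \<circ> g)"
proof -
  obtain m where m: "is_moebius m"
    "\<And>x. x \<in> riemann_sphere \<Longrightarrow> f x \<in> riemann_sphere \<and> stereo (f x) = m (stereo x)"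
    using assms unfolding sphere_moebius_def by blast
  obtain k where k: "is_moebius k"
    "\<And>x. x \<in> riemann_sphere \<Longrightarrow> g x \<in> riemann_sphere \<and> stereo (g x) = k (stereo x)"
    using assms unfolding sphere_moebius_def by blast
  show ?thesis unfolding sphere_moebius_def
    using m k is_moebius_comp[OF m(1) k(1)] by (intro exI[of _ "m \<circ> k"]) auto
qed

lemma sphere_moebius_inverse:
  assumes "sphere_moebius f" "\<And>x. x \<in> riemann_sphere \<Longrightarrow> g x \<in> riemann_sphere \<and> f (g x) = x"
  shows "sphere_moebius g"
proof -
  obtain m where m: "is_moebius m"
    "\<And>x. x \<in> riemann_sphere \<Longrightarrow> f x \<in> riemann_sphere \<and> stereo (f x) = m (stereo x)"
    using assms unfolding sphere_moebius_def by blast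
  obtain k where k: "is_moebius k" "m \<circ> k = id" "k \<circ> m = id"
    using is_moebius_inverse[OF m(1)] by blast
  have "stereo (g x) = k (stereo x)" if "x \<in> riemann_sphere" for x
    using m(2)[of "g x"] assms(2)[OF that] fun_cong[OF k(3), of "stereo (g x)"] by simp
  then show ?thesis unfolding sphere_moebius_def using k(1) assms(2) by blast
qed

lemma sphere_moebius_bij:
  assumes "sphere_moebius f"
  shows "bij_betw f riemann_sphere riemann_sphere"
proof -
  obtain m where m: "is_moebius m"
    "\<And>x. x \<in> riemann_sphere \<Longrightarrow> f x \<in> riemann_sphere \<and> stereo (f x) = m (stereo x)"
    using assms unfolding sphere_moebius_def by blast
  have bij: "bij m" using m is_moebius_bij by blast
  show ?thesis unfolding bij_betw_def
  proof
    show "inj_on f riemann_sphere"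
      by (rule inj_onI) (metis m(2) bij bij_is_inj inj_eq stereo_eq_iff)
    have "\<exists>x\<in>riemann_sphere. f x = y" if y: "y \<in> riemann_sphere" for y
    proof -
      obtain x where "x \<in> riemann_sphere" "stereo x = inv m (stereo y)" using stereo_surj by blast
      then show ?thesis using m(2)[of x] y bij stereo_eq_iff[of "f x" y]
        by (auto simp: bij_is_surj surj_f_inv_f)
    qed
    then show "f ` riemann_sphere = riemann_sphere" using m(2) by blast
  qed
qed

lemma moebius_group_subgroup: "subgroup moebius_group (BijGroup riemann_sphere)"
proof -
  have Bij: "f \<in> Bij riemann_sphere" if "f \<in> moebius_group" for f
    using that sphere_moebius_bij by (auto simp: Bij_def moebius_group_iff)
  show ?thesis
  proof (rule group.subgroupI[OF group_BijGroup])
    show "moebius_group \<subseteq> carrier (BijGroup riemann_sphere)"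
      using Bij by (auto simp: BijGroup_def)
    have "sphere_moebius id" unfolding sphere_moebius_def using is_moebius_id by (intro exI[of _ id]) auto
    then show "moebius_group \<noteq> {}" using restrict_in_moebius_group by blast
    show "m_inv (BijGroup riemann_sphere) f \<in> moebius_group" if f: "f \<in> moebius_group" for f
    proof -
      have b: "bij_betw f riemann_sphere riemann_sphere" using Bij[OF f] by (simp add: Bij_def)
      have "sphere_moebius (inv_into riemann_sphere f)"
      proof (rule sphere_moebius_inverse)
        show "sphere_moebius f" using f by (simp add: moebius_group_iff)
        show "inv_into riemann_sphere f x \<in> riemann_sphere \<and> f (inv_into riemann_sphere f x) = x"
          if "x \<in> riemann_sphere" for x
          using b that unfolding bij_betw_def by (metis inv_into_into f_inv_into_f)
      qed
      then show ?thesis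
        unfolding inv_BijGroup[OF Bij[OF f]] by (rule restrict_in_moebius_group)
    qed
    show "f \<otimes>\<^bsub>BijGroup riemann_sphere\<^esub> g \<in> moebius_group"
      if "f \<in> moebius_group" "g \<in> moebius_group" for f g
    proof -
      have "f \<otimes>\<^bsub>BijGroup riemann_sphere\<^esub> g = restrict (f \<circ> g) riemann_sphere"
        using Bij that by (simp add: BijGroup_def compose_def comp_def)
      then show ?thesis
        using that sphere_moebius_comp restrict_in_moebius_group by (simp add: moebius_group_iff)
    qed
  qed
qed

lemma moebius_group_three_fixed_points:
  assumes f: "f \<in> moebius_group" and A: "A \<subseteq> riemann_sphere" "3 \<le> card A" "\<And>x. x \<in> A \<Longrightarrow> f x = x"
    and x: "x \<in> riemann_sphere"
  shows "f x = x"
proof -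
  obtain m where m: "is_moebius m"
    "\<And>x. x \<in> riemann_sphere \<Longrightarrow> f x \<in> riemann_sphere \<and> stereo (f x) = m (stereo x)"
    using f unfolding moebius_group_iff sphere_moebius_def by blast
  have "inj_on stereo A" using A bij_betw_stereo by (meson bij_betw_def inj_on_subset)
  then have card: "3 \<le> card (stereo ` A)" using A by (simp add: card_image)
  have "m = id"
  proof (rule moebius_three_fixed_points[OF m(1) card])
    show "m w = w" if "w \<in> stereo ` A" for w
      using that A m(2) by (metis imageE subsetD)
  qed
  then show ?thesis using m(2)[OF x] x stereo_eq_iff by (metis id_apply)
qed

lemma moebius_group_finite_order_fixed_points:
  assumes f: "f \<in> moebius_group" "f \<noteq> restrict id riemann_sphere"
    and n: "\<And>x. x \<in> riemann_sphere \<Longrightarrow> (f ^^ n) x = x" "n > 0"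
  shows "card {x \<in> riemann_sphere. f x = x} = 2"
proof -
  obtain m where m: "is_moebius m"
    "\<And>x. x \<in> riemann_sphere \<Longrightarrow> f x \<in> riemann_sphere \<and> stereo (f x) = m (stereo x)"
    using f unfolding moebius_group_iff sphere_moebius_def by blast
  have pow: "(f ^^ k) x \<in> riemann_sphere \<and> stereo ((f ^^ k) x) = (m ^^ k) (stereo x)"
    if "x \<in> riemann_sphere" for k x
  proof (induction k)
    case (Suc k)
    then show ?case using m(2)[of "(f ^^ k) x"] by (simp del: mem_sphere_0)
  qed (use that in simp)
  have fix_iff: "f x = x \<longleftrightarrow> m (stereo x) = stereo x" if "x \<in> riemann_sphere" for x
    using m(2)[OF that] that stereo_eq_iff by (metis (no_types))
  have "m \<noteq> id"
  proof
    assume "m = id"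
    have "f = restrict id riemann_sphere"
    proof (rule extensionalityI)
      show "f x = restrict id riemann_sphere x" if "x \<in> riemann_sphere" for x
        using fix_iff[OF that] that by (simp add: \<open>m = id\<close>)
    qed (use f(1) in \<open>auto simp: moebius_group_iff\<close>)
    with f(2) show False by simp
  qed
  moreover have "m ^^ n = id"
  proof
    fix w
    obtain x where x: "x \<in> riemann_sphere" "stereo x = w" using stereo_surj by blast
    show "(m ^^ n) w = id w" using pow[OF x(1), of n] n(1)[OF x(1)] x(2) by simp
  qed
  ultimately have "card {w. m w = w} = 2" using finite_order_moebius_fixed_points m(1) n(2) by blast
  moreover have "bij_betw stereo {x \<in> riemann_sphere. f x = x} {w. m w = w}"
    unfolding bij_betw_def
  proof
    show "inj_on stereo {x \<in> riemann_sphere. f x = x}"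
      using bij_betw_stereo unfolding bij_betw_def by (rule_tac inj_on_subset) auto
    show "stereo ` {x \<in> riemann_sphere. f x = x} = {w. m w = w}"
    proof (intro equalityI subsetI)
      fix w assume w: "w \<in> {w. m w = w}"
      obtain x where x: "x \<in> riemann_sphere" "stereo x = w" using stereo_surj by blast
      then have "f x = x" using fix_iff w by simp
      with x show "w \<in> stereo ` {x \<in> riemann_sphere. f x = x}" by blast
    qed (use fix_iff in auto)
  qed
  ultimately show ?thesis by (simp add: bij_betw_same_card)
qed

section \<open>Rotations are Moebius maps\<close>

definition rotate_z :: "real \<Rightarrow> real \<Rightarrow> real^3 \<Rightarrow> real^3" where
  "rotate_z c s x = vector [c * x$1 - s * x$2, s * x$1 + c * x$2, x$3]"

definition rotate_y :: "real \<Rightarrow> real \<Rightarrow> real^3 \<Rightarrow> real^3" where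
  "rotate_y c s x = vector [c * x$1 - s * x$3, x$2, s * x$1 + c * x$3]"

lemma sphere_iff: "x \<in> riemann_sphere \<longleftrightarrow> (x$1)\<^sup>2 + (x$2)\<^sup>2 + (x$3)\<^sup>2 = 1"
  for x :: "real^3"
  by (simp add: norm_vec_def L2_set_def sum_3)

lemma linear_rotate_z: "linear (rotate_z c s)"
  and linear_rotate_y: "linear (rotate_y c s)"
  by (auto intro!: linearI simp: rotate_z_def rotate_y_def vec_eq_iff forall_3 algebra_simps)

lemma orthogonal_rotate_z: "c\<^sup>2 + s\<^sup>2 = 1 \<Longrightarrow> orthogonal_transformation (rotate_z c s)"
  and orthogonal_rotate_y: "c\<^sup>2 + s\<^sup>2 = 1 \<Longrightarrow> orthogonal_transformation (rotate_y c s)"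
  unfolding orthogonal_transformation_def
  by (simp_all add: linear_rotate_z linear_rotate_y rotate_z_def rotate_y_def inner_vec_def sum_3,
      Groebner_Basis.algebra+)

lemma det_rotate_z: "c\<^sup>2 + s\<^sup>2 = 1 \<Longrightarrow> det (matrix (rotate_z c s)) = 1"
  and det_rotate_y: "c\<^sup>2 + s\<^sup>2 = 1 \<Longrightarrow> det (matrix (rotate_y c s)) = 1"
  by (simp_all add: det_3 matrix_def rotate_z_def rotate_y_def axis_def power2_eq_square)

lemma rotate_z_inverse: "c\<^sup>2 + s\<^sup>2 = 1 \<Longrightarrow> rotate_z c (- s) (rotate_z c s x) = x"
  and rotate_y_inverse: "c\<^sup>2 + s\<^sup>2 = 1 \<Longrightarrow> rotate_y c (- s) (rotate_y c s x) = x"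
  by (simp_all add: rotate_z_def rotate_y_def vec_eq_iff forall_3, Groebner_Basis.algebra+)

lemma orthogonal_sphere: 
  "orthogonal_transformation f \<Longrightarrow> x \<in> riemann_sphere \<Longrightarrow> f x \<in> riemann_sphere"
  by (simp add: orthogonal_transformation_norm)

lemma sphere_moebius_rotate_z:
  assumes "c\<^sup>2 + s\<^sup>2 = 1"
  shows "sphere_moebius (rotate_z c s)"
  unfolding sphere_moebius_def
proof (intro exI conjI ballI)
  have "Complex c s \<noteq> 0" using assms by (auto simp: complex_eq_iff)
  then show "is_moebius (moebius_ext (Complex c s) 0 0 1)"
    unfolding is_moebius_def by (metis diff_zero mult.right_neutral mult_zero_left)
  fix x :: "real^3" assume x: "x \<in> riemann_sphere"
  show "rotate_z c s x \<in> riemann_sphere"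
    using orthogonal_sphere[OF orthogonal_rotate_z[OF assms] x] .
  show "stereo (rotate_z c s x) = moebius_ext (Complex c s) 0 0 1 (stereo x)"
    by (auto simp: stereo_def rotate_z_def moebius_ext_def moebius_def complex_eq_iff
        add_divide_distrib diff_divide_distrib)
qed

text \<open>The matrix with rows \<open>(c, s)\<close> and \<open>(- s, c)\<close> acts on the sphere as a rotation by twice its angle. Once
  the denominators coming from the two stereographic projections are cleared, this becomes a
  polynomial identity that follows from the equation of the sphere.\<close>

lemma sphere_moebius_rotate_y_double:
  assumes "c\<^sup>2 + s\<^sup>2 = 1"
  shows "sphere_moebius (rotate_y (c\<^sup>2 - s\<^sup>2) (2 * c * s))"
  unfolding sphere_moebius_def
proof (intro exI conjI ballI)
  let ?c = "complex_of_real c" and ?s = "complex_of_real s"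
  have "?c * ?c - ?s * (- ?s) = complex_of_real (c\<^sup>2 + s\<^sup>2)"
    by (simp add: power2_eq_square)
  then have "?c * ?c - ?s * (- ?s) \<noteq> 0" using assms by simp
  then show "is_moebius (moebius_ext ?c ?s (- ?s) ?c)"
    unfolding is_moebius_def by blast
  fix x :: "real^3" assume x: "x \<in> riemann_sphere"
  let ?y = "rotate_y (c\<^sup>2 - s\<^sup>2) (2 * c * s) x"
  have "(c\<^sup>2 - s\<^sup>2)\<^sup>2 + (2 * c * s)\<^sup>2 = (c\<^sup>2 + s\<^sup>2)\<^sup>2" by (simp add: power2_eq_square algebra_simps)
  then show "?y \<in> riemann_sphere"
    using orthogonal_sphere[OF orthogonal_rotate_y x] assms by simp
  have eq: "(x$1)\<^sup>2 + (x$2)\<^sup>2 + (x$3)\<^sup>2 = 1" using x sphere_iff by blast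
  show "stereo ?y = moebius_ext ?c ?s (- ?s) ?c (stereo x)"
  proof (cases "x$3 = 1")
    case True
    then have x12: "x$1 = 0" "x$2 = 0" using eq by (simp_all add: sum_power2_eq_zero_iff)
    have y: "?y$1 = - 2 * c * s" "?y$2 = 0" "1 - ?y$3 = 2 * s\<^sup>2"
      using True x12 assms by (simp_all add: rotate_y_def)
    show ?thesis
    proof (cases "s = 0")
      case True
      then have "?y$3 = 1" using y by simp
      with True \<open>x$3 = 1\<close> show ?thesis by (simp add: stereo_def moebius_ext_def)
    next
      case False
      then have "?y$3 \<noteq> 1" using y(3) by auto
      then have "stereo ?y = Some (Complex (- 2 * c * s / (2 * s\<^sup>2)) 0)"
        unfolding stereo_def y by simp
      also have "- 2 * c * s / (2 * s\<^sup>2) = - c / s" by (simp add: power2_eq_square)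
      also have "Complex (- c / s) 0 = ?c / (- ?s)" by (simp add: complex_eq_iff)
      finally show ?thesis using False \<open>x$3 = 1\<close> by (simp add: stereo_def moebius_ext_def)
    qed
  next
    case False
    define k where "k = 1 - x$3"
    define k' where "k' = 1 - ?y$3"
    define z where "z = Complex (x$1 / k) (x$2 / k)"
    have k0: "k \<noteq> 0" using False by (simp add: k_def)
    have x3: "x$3 = 1 - k" by (simp add: k_def)
    have sx: "stereo x = Some z" using False by (simp add: stereo_def z_def k_def)
    have k': "k' = 1 - (2 * c * s * x$1 + (c\<^sup>2 - s\<^sup>2) * (1 - k))"
      unfolding k'_def by (simp add: rotate_y_def x3)
    have y1: "?y$1 = (c\<^sup>2 - s\<^sup>2) * x$1 - 2 * c * s * (1 - k)" and y2: "?y$2 = x$2"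
      by (simp_all add: rotate_y_def x3)
    have eqk: "(x$1)\<^sup>2 + (x$2)\<^sup>2 + (1 - k)\<^sup>2 = 1" using eq x3 by simp
    \<comment> \<open>Up to the factor \<open>k\<^sup>2\<close>, the squared modulus of the denominator of the Moebius map.\<close>
    have norm: "(c * k - s * x$1)\<^sup>2 + (s * x$2)\<^sup>2 = k * k'"
      using eqk assms unfolding k' by Groebner_Basis.algebra
    have den: "- ?s * z + ?c = Complex ((c * k - s * x$1) / k) (- (s * x$2) / k)"
      using k0 by (simp add: z_def complex_eq_iff diff_divide_distrib)
    show ?thesis
    proof (cases "k' = 0")
      case True
      then have "c * k - s * x$1 = 0" "s * x$2 = 0" using norm by (simp_all add: sum_power2_eq_zero_iff)
      then have "- ?s * z + ?c = 0" unfolding den by (simp add: complex_eq_iff)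
      then have "moebius_ext ?c ?s (- ?s) ?c (stereo x) = None" unfolding sx by (simp add: moebius_ext_def)
      moreover have "stereo ?y = None" using True k'_def by (simp add: stereo_def)
      ultimately show ?thesis by simp
    next
      case False
      then have "c * k - s * x$1 \<noteq> 0 \<or> s * x$2 \<noteq> 0" using norm k0 by auto
      then have den0: "- ?s * z + ?c \<noteq> 0" unfolding den using k0 by (auto simp: complex_eq_iff)
      have frac: "a / k = u / k' * (v / k) - w / k' * (q / k)" if "a * k' = u * v - w * q" for a u v w q
      proof -
        have "u / k' * (v / k) - w / k' * (q / k) = (u * v - w * q) / (k' * k)"
          by (simp add: diff_divide_distrib)
        then show ?thesis using False by (simp flip: that)
      qed
      have "(c * x$1 + s * k) * k' = ?y$1 * (c * k - s * x$1) - ?y$2 * (- (s * x$2))"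
        unfolding y1 y2 k' using eqk assms by Groebner_Basis.algebra
      from frac[OF this]
      have re: "c * (x$1 / k) + s = ?y$1 / k' * ((c * k - s * x$1) / k) - ?y$2 / k' * (- (s * x$2) / k)"
        using k0 by (simp add: add_divide_distrib)
      have "(c * x$2) * k' = ?y$2 * (c * k - s * x$1) - ?y$1 * (s * x$2)"
        unfolding y1 y2 k' using eqk assms by Groebner_Basis.algebra
      from frac[OF this]
      have im: "c * (x$2 / k) = ?y$1 / k' * (- (s * x$2) / k) + ?y$2 / k' * ((c * k - s * x$1) / k)"
        by simp
      have "?c * z + ?s = Complex (?y$1 / k') (?y$2 / k') * (- ?s * z + ?c)"
        unfolding den using re im by (simp add: complex_eq_iff z_def)
      then have "moebius ?c ?s (- ?s) ?c z = Complex (?y$1 / k') (?y$2 / k')"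
        using den0 by (simp add: moebius_def)
      then have "moebius_ext ?c ?s (- ?s) ?c (stereo x) = Some (Complex (?y$1 / k') (?y$2 / k'))"
        unfolding sx using den0 by (simp add: moebius_ext_def)
      moreover have "stereo ?y = Some (Complex (?y$1 / k') (?y$2 / k'))"
        using False by (simp add: stereo_def k'_def)
      ultimately show ?thesis by simp
    qed
  qed
qed

lemma sphere_moebius_rotate_y:
  assumes "c\<^sup>2 + s\<^sup>2 = 1"
  shows "sphere_moebius (rotate_y c s)"
proof -
  obtain t where t: "c = cos t" "s = sin t" using sincos_total_2pi[OF assms] by metis
  have "c = (cos (t/2))\<^sup>2 - (sin (t/2))\<^sup>2" "s = 2 * cos (t/2) * sin (t/2)"
    using cos_double[of "t/2"] sin_double[of "t/2"] t by simp_all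
  then show ?thesis using sphere_moebius_rotate_y_double[of "cos (t/2)" "sin (t/2)"] by simp
qed

lemma rotation_fixing_north:
  fixes h :: "real^3 \<Rightarrow> real^3"
  assumes h: "orthogonal_transformation h" "det (matrix h) = 1" and n: "h (axis 3 1) = axis 3 1"
  obtains c s where "c\<^sup>2 + s\<^sup>2 = 1" "h = rotate_z c s"
proof -
  define u v where "u = h (axis 1 1)" and "v = h (axis 2 1)"
  have lin: "linear h" and inn: "\<And>x y. h x \<bullet> h y = x \<bullet> y"
    using h by (auto simp: orthogonal_transformation_def)
  have u3: "u$3 = 0" and v3: "v$3 = 0"
    using inn[of "axis 1 1" "axis 3 1"] inn[of "axis 2 1" "axis 3 1"]
    unfolding n u_def[symmetric] v_def[symmetric] by (simp_all add: inner_axis) (simp_all add: axis_def)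
  have uu: "(u$1)\<^sup>2 + (u$2)\<^sup>2 = 1" and vv: "(v$1)\<^sup>2 + (v$2)\<^sup>2 = 1" and uv: "u$1 * v$1 + u$2 * v$2 = 0"
    using inn[of "axis 1 1" "axis 1 1"] inn[of "axis 2 1" "axis 2 1"] inn[of "axis 1 1" "axis 2 1"] u3 v3
    unfolding u_def[symmetric] v_def[symmetric]
    by (simp_all add: inner_vec_def sum_3 axis_def power2_eq_square)
  have "matrix h $ i $ 1 = u$i" "matrix h $ i $ 2 = v$i" "matrix h $ i $ 3 = axis 3 1 $ i" for i
    by (simp_all add: matrix_def u_def v_def n)
  then have det: "u$1 * v$2 - u$2 * v$1 = 1"
    using h(2) u3 v3 by (simp add: det_3 axis_def algebra_simps)
  \<comment> \<open>For an orthonormal pair of determinant 1, the second vector is the first one turned by \<open>\<pi>/2\<close>.\<close>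
  have "(u$1 - v$2)\<^sup>2 + (u$2 + v$1)\<^sup>2 = 0"
    using uu vv det by Groebner_Basis.algebra
  then have v: "v$2 = u$1" "v$1 = - u$2" by (simp_all add: sum_power2_eq_zero_iff)
  have "h x = rotate_z (u$1) (u$2) x" for x
  proof -
    have "x = x$1 *\<^sub>R axis 1 1 + x$2 *\<^sub>R axis 2 1 + x$3 *\<^sub>R axis 3 1"
      by (simp add: vec_eq_iff forall_3 axis_def)
    then have "h x = h (x$1 *\<^sub>R axis 1 1 + x$2 *\<^sub>R axis 2 1 + x$3 *\<^sub>R axis 3 1)" by simp
    also have "\<dots> = x$1 *\<^sub>R u + x$2 *\<^sub>R v + x$3 *\<^sub>R axis 3 1"
      using lin by (simp add: linear_add linear_scale u_def v_def n)
    finally show ?thesis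
      by (simp add: rotate_z_def vec_eq_iff forall_3 u3 v3 v axis_def algebra_simps)
  qed
  then show thesis using that uu by blast
qed

text \<open>A decomposition into Euler angles: a turn about the third axis moves the image \<open>p\<close> of the north
  pole into the plane \<open>x\<^sub>2 = 0\<close>, a turn about the second axis moves it on to the north pole, and the
  rotation that remains fixes the north pole.\<close>

theorem rotation_sphere_moebius:
  fixes f :: "real^3 \<Rightarrow> real^3"
  assumes f: "orthogonal_transformation f" "det (matrix f) = 1"
  shows "sphere_moebius f"
proof -
  define p where "p = f (axis 3 1)"
  have p: "(p$1)\<^sup>2 + (p$2)\<^sup>2 + (p$3)\<^sup>2 = 1"
    using f by (simp flip: sphere_iff add: p_def orthogonal_transformation_norm)
  define r where "r = sqrt ((p$1)\<^sup>2 + (p$2)\<^sup>2)"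
  have r: "r\<^sup>2 = (p$1)\<^sup>2 + (p$2)\<^sup>2" by (simp add: r_def)
  obtain c s where cs: "c\<^sup>2 + s\<^sup>2 = 1" "rotate_z c s p = vector [r, 0, p$3]"
  proof (cases "r = 0")
    case True
    then have "p$1 = 0" "p$2 = 0" using r by (simp_all add: sum_power2_eq_zero_iff)
    with True show thesis using that[of 1 0] by (simp add: rotate_z_def)
  next
    case False
    have "(p$1 / r)\<^sup>2 + (- p$2 / r)\<^sup>2 = 1"
      using False by (simp add: power_divide flip: add_divide_distrib r)
    moreover have "p$1 / r * p$1 - - p$2 / r * p$2 = r"
      using r False by (simp add: field_simps power2_eq_square)
    ultimately show thesis using that[of "p$1 / r" "- p$2 / r"] by (simp add: rotate_z_def)
  qed
  have rp: "(p$3)\<^sup>2 + r\<^sup>2 = 1" using p r by simp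
  let ?h = "rotate_y (p$3) r \<circ> (rotate_z c s \<circ> f)"
  have orth: "orthogonal_transformation ?h"
    using f cs rp orthogonal_rotate_z orthogonal_rotate_y by (intro orthogonal_transformation_compose)
  have lin: "linear f" "linear (rotate_z c s \<circ> f)"
    using f linear_rotate_z by (auto simp: orthogonal_transformation_def intro: linear_compose)
  have "det (matrix ?h) = 1"
    using f cs rp lin by (simp add: matrix_compose det_mul linear_rotate_y linear_rotate_z det_rotate_y det_rotate_z)
  moreover have "?h (axis 3 1) = rotate_y (p$3) r (vector [r, 0, p$3])"
    by (simp only: o_apply cs(2) flip: p_def)
  moreover have "rotate_y (p$3) r (vector [r, 0, p$3]) = axis 3 1"
    using rp by (simp add: rotate_y_def vec_eq_iff forall_3 axis_def power2_eq_square algebra_simps)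
  ultimately obtain c' s' where h: "c'\<^sup>2 + s'\<^sup>2 = 1" "?h = rotate_z c' s'"
    using rotation_fixing_north[OF orth] by metis
  have "f x = (rotate_z c (- s) \<circ> (rotate_y (p$3) (- r) \<circ> rotate_z c' s')) x" for x
  proof -
    have "rotate_y (p$3) (- r) (rotate_z c' s' x) = rotate_z c s (f x)"
      using rotate_y_inverse[OF rp, of "rotate_z c s (f x)"] fun_cong[OF h(2), of x] by simp
    then show ?thesis using rotate_z_inverse[OF cs(1), of "f x"] by simp
  qed
  then have "f = rotate_z c (- s) \<circ> (rotate_y (p$3) (- r) \<circ> rotate_z c' s')" by blast
  moreover have "sphere_moebius (rotate_z c (- s) \<circ> (rotate_y (p$3) (- r) \<circ> rotate_z c' s'))"
    using h(1) cs(1) rp by (intro sphere_moebius_comp sphere_moebius_rotate_z sphere_moebius_rotate_y) simp_all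
  ultimately show ?thesis by simp
qed

section \<open>Polytopes cut into reflection chambers\<close>

text \<open>The reflection in the plane orthogonal to \<open>a\<close>, and the identity for \<open>a = 0\<close>.\<close>

definition mirror :: "real^3 \<Rightarrow> real^3 \<Rightarrow> real^3" where
  "mirror a x = x - (2 * (x \<bullet> a) / (a \<bullet> a)) *\<^sub>R a"

lemma linear_mirror: "linear (mirror a)"
  by (rule linearI)
    (simp_all add: mirror_def inner_add_left algebra_simps add_divide_distrib scaleR_add_left)

lemma mirror_self_adjoint: "mirror a x \<bullet> y = x \<bullet> mirror a y"
  by (simp add: mirror_def inner_diff_left inner_diff_right inner_commute)

lemma mirror_mirror: "mirror a (mirror a x) = x"
proof (cases "a = 0")
  case False
  then have "mirror a x \<bullet> a = - (x \<bullet> a)" by (simp add: mirror_def inner_diff_left)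
  then have "mirror a (mirror a x) = mirror a x + (2 * (x \<bullet> a) / (a \<bullet> a)) *\<^sub>R a"
    by (subst mirror_def) simp
  then show ?thesis by (simp add: mirror_def)
qed (simp add: mirror_def)

lemma mirror_image_eq: "mirror a ` S \<subseteq> S \<Longrightarrow> mirror a ` S = S"
  by (metis (no_types, lifting) image_subset_iff mirror_mirror subsetI subset_antisym image_eqI)

lemma orthogonal_mirror: "orthogonal_transformation (mirror a)"
  unfolding orthogonal_transformation_def
  by (simp add: linear_mirror mirror_self_adjoint mirror_mirror)

lemma mirror_fixed: "x \<bullet> a = 0 \<Longrightarrow> mirror a x = x"
  by (simp add: mirror_def)

lemma det_mirror:
  assumes "a \<noteq> 0"
  shows "det (matrix (mirror a)) = -1"
proof -
  define q where "q = a \<bullet> a"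
  have "q \<noteq> 0" using assms by (simp add: q_def)
  moreover have "q = (a$1)\<^sup>2 + (a$2)\<^sup>2 + (a$3)\<^sup>2"
    by (simp add: q_def inner_vec_def sum_3 power2_eq_square)
  moreover define c where "c = 2 / q"
  ultimately have c: "c * ((a$1)\<^sup>2 + (a$2)\<^sup>2 + (a$3)\<^sup>2) = 2" by (metis nonzero_eq_divide_eq)
  have "mirror a (axis j 1) = axis j 1 - (c * a$j) *\<^sub>R a" for j
    by (simp add: mirror_def inner_axis' c_def q_def)
  then have m: "matrix (mirror a) $ i $ j = (if i = j then 1 else 0) - c * a$j * a$i" for i j
    by (simp add: matrix_def axis_def)
  have "det (matrix (mirror a)) = 1 - c * ((a$1)\<^sup>2 + (a$2)\<^sup>2 + (a$3)\<^sup>2)"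
    unfolding det_3 m by (simp add: algebra_simps power2_eq_square)
  then show ?thesis unfolding c by simp
qed

lemma mirror_components:
  "mirror a x $ i = x$i - 2 * (x$1 * a$1 + x$2 * a$2 + x$3 * a$3)
    / ((a$1)\<^sup>2 + (a$2)\<^sup>2 + (a$3)\<^sup>2) * a$i"
  by (simp add: mirror_def inner_vec_def sum_3 power2_eq_square)

definition symmetries :: "(real^3) set \<Rightarrow> (real^3 \<Rightarrow> real^3) set" where
  "symmetries P = {g. orthogonal_transformation g \<and> g ` P = P}"

lemma symmetries_comp: "g \<in> symmetries P \<Longrightarrow> h \<in> symmetries P \<Longrightarrow> g \<circ> h \<in> symmetries P"
  by (auto simp: symmetries_def intro: orthogonal_transformation_compose simp flip: image_image)

lemma symmetries_inv:
  assumes "g \<in> symmetries P" shows "inv g \<in> symmetries P"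
proof -
  have "orthogonal_transformation g" "g ` P = P" using assms by (auto simp: symmetries_def)
  moreover from this have "inv g ` P = P"
    by (metis image_inv_f_f orthogonal_transformation_inj)
  ultimately show ?thesis by (simp add: symmetries_def orthogonal_transformation_inv)
qed

lemma symmetry_linear: "g \<in> symmetries P \<Longrightarrow> linear g"
  and symmetry_inj: "g \<in> symmetries P \<Longrightarrow> inj g"
  by (auto simp: symmetries_def orthogonal_transformation_def orthogonal_transformation_inj)

lemma symmetry_face:
  assumes "g \<in> symmetries P" "D face_of P"
  shows "g ` D face_of P" "aff_dim (g ` D) = aff_dim D"
proof -
  have "g ` D face_of g ` P"
    using assms symmetry_linear symmetry_inj by (subst face_of_linear_image) auto
  then show "g ` D face_of P" using assms by (simp add: symmetries_def)
  show "aff_dim (g ` D) = aff_dim D"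
    using assms symmetry_linear symmetry_inj by (intro aff_dim_injective_linear_image) auto
qed

text \<open>A symmetry permutes the finitely many extreme points, and it is linear; so its value at a convex
  combination of extreme points is determined by that permutation.\<close>

lemma finite_symmetry_orbit:
  assumes P: "polytope P" and x: "x \<in> P"
  shows "finite ((\<lambda>g. g x) ` symmetries P)"
proof -
  define X where "X = {v. v extreme_point_of P}"
  have fin: "finite X"
    using P by (simp add: X_def finite_polyhedron_extreme_points polytope_imp_polyhedron)
  have hull: "P = convex hull X"
    using P Krein_Milman_Minkowski[of P] by (simp add: X_def polytope_imp_compact polytope_imp_convex)
  then obtain u where u: "(\<Sum>y\<in>X. u y *\<^sub>R y) = x"
    using x fin by (auto simp: convex_hull_finite)
  have "(\<lambda>g. g x) ` symmetries P \<subseteq> (\<lambda>h. \<Sum>y\<in>X. u y *\<^sub>R h y) ` (X \<rightarrow>\<^sub>E X)"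
  proof
    fix z assume "z \<in> (\<lambda>g. g x) ` symmetries P"
    then obtain g where g: "g \<in> symmetries P" "z = g x" by blast
    have "g y \<in> X" if "y \<in> X" for y
      using symmetry_face(1)[OF g(1), of "{y}"] that by (simp add: X_def face_of_singleton)
    then have "restrict g X \<in> X \<rightarrow>\<^sub>E X" by auto
    moreover have "z = (\<Sum>y\<in>X. u y *\<^sub>R restrict g X y)"
      unfolding g(2) u[symmetric] using symmetry_linear[OF g(1)]
      by (simp add: linear_sum linear_scale)
    ultimately show "z \<in> (\<lambda>h. \<Sum>y\<in>X. u y *\<^sub>R h y) ` (X \<rightarrow>\<^sub>E X)" by blast
  qed
  then show ?thesis using finite_PiE[OF fin] fin by (metis (no_types, lifting) finite_imageI finite_subset)
qed

text \<open>The points \<open>v\<close>, \<open>e\<close>, \<open>f\<close> are a vertex, the midpoint of an edge and the centre of a facet, each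
  incident with the next. They span a cone, the chamber; \<open>a\<^sub>v\<close> is the inward normal of the wall
  opposite to \<open>v\<close>, and likewise for \<open>a\<^sub>e\<close> and \<open>a\<^sub>f\<close>. By \<open>support\<close> the three points lie in the
  plane of the facet, which is orthogonal to \<open>f\<close>. The segments in the last assumptions say that
  a face through \<open>e\<close> contains \<open>v\<close> and that a face through \<open>f\<close> contains \<open>v\<close> and \<open>e\<close>.\<close>

locale reflection_polytope =
  fixes P :: "(real^3) set" and v e f a\<^sub>v a\<^sub>e a\<^sub>f :: "real^3"
  assumes polytope: "polytope P"
    and antipodal: "\<And>x. x \<in> P \<Longrightarrow> - x \<in> P"
    and mirrors: "\<And>a. a \<in> {a\<^sub>v, a\<^sub>e, a\<^sub>f} \<Longrightarrow> mirror a ` P = P"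
    and wall_v: "v \<bullet> a\<^sub>v > 0" "e \<bullet> a\<^sub>v = 0" "f \<bullet> a\<^sub>v = 0"
    and wall_e: "v \<bullet> a\<^sub>e = 0" "e \<bullet> a\<^sub>e > 0" "f \<bullet> a\<^sub>e = 0"
    and wall_f: "v \<bullet> a\<^sub>f = 0" "e \<bullet> a\<^sub>f = 0" "f \<bullet> a\<^sub>f > 0"
    and expansion: "\<And>x. x = (x \<bullet> a\<^sub>v / (v \<bullet> a\<^sub>v)) *\<^sub>R v + (x \<bullet> a\<^sub>e / (e \<bullet> a\<^sub>e)) *\<^sub>R e
      + (x \<bullet> a\<^sub>f / (f \<bullet> a\<^sub>f)) *\<^sub>R f"
    and flag_in: "v \<in> P" "e \<in> P" "f \<in> P"
    and support: "\<And>x. x \<in> P \<Longrightarrow> f \<bullet> x \<le> f \<bullet> f" "f \<bullet> v = f \<bullet> f" "f \<bullet> e = f \<bullet> f"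
    and edge_segment: "\<exists>w\<in>P. e \<in> open_segment v w"
    and face_segments: "\<exists>w\<in>P. f \<in> open_segment v w" "\<exists>w\<in>P. f \<in> open_segment e w"
begin

lemma convex: "convex P"
  using polytope by (rule polytope_imp_convex)

lemma zero_in: "0 \<in> P"
proof -
  have "(1/2) *\<^sub>R v + (1/2) *\<^sub>R (- v) \<in> P"
    by (rule convexD[OF convex]) (use flag_in antipodal in auto)
  then show ?thesis by simp
qed

lemma mirror_symmetry: "a \<in> {a\<^sub>v, a\<^sub>e, a\<^sub>f} \<Longrightarrow> mirror a \<in> symmetries P"
  using mirrors orthogonal_mirror by (simp add: symmetries_def)

text \<open>The usual argument for finite reflection groups. Among the images of \<open>x\<close> under symmetries, one
  with the largest inner product with a fixed vector \<open>\<rho>\<close> inside the chamber lies in the chamber: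
  a reflection in a wall that separated it from \<open>\<rho>\<close> would increase the inner product.\<close>

lemma move_to_chamber:
  assumes x: "x \<in> P"
  obtains g \<alpha> \<beta> \<gamma> where "g \<in> symmetries P" "\<alpha> \<ge> 0" "\<beta> \<ge> 0" "\<gamma> \<ge> 0" "g x = \<alpha> *\<^sub>R v + \<beta> *\<^sub>R e + \<gamma> *\<^sub>R f"
proof -
  define \<rho> where "\<rho> = v + e + f"
  let ?O = "(\<lambda>g. g x) ` symmetries P"
  have "id \<in> symmetries P" by (simp add: symmetries_def id_def orthogonal_transformation_id)
  then have O: "finite ?O" "?O \<noteq> {}" using finite_symmetry_orbit[OF polytope x] by auto
  define y where "y = arg_min_on (\<lambda>z. - (z \<bullet> \<rho>)) ?O"
  have y: "y \<in> ?O" "\<And>z. z \<in> ?O \<Longrightarrow> z \<bullet> \<rho> \<le> y \<bullet> \<rho>"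
    using arg_min_if_finite(1)[OF O] arg_min_least[OF O, of _ "\<lambda>z. - (z \<bullet> \<rho>)"]
    unfolding y_def by (blast, simp)
  then obtain g where g: "g \<in> symmetries P" "y = g x" by blast
  have pos: "y \<bullet> a \<ge> 0" if a: "a \<in> {a\<^sub>v, a\<^sub>e, a\<^sub>f}" for a
  proof -
    have \<rho>: "a \<bullet> \<rho> > 0"
      using a wall_v wall_e wall_f by (auto simp: \<rho>_def inner_add_right inner_commute)
    then have aa: "a \<bullet> a > 0" by auto
    have "mirror a \<circ> g \<in> symmetries P" using symmetries_comp mirror_symmetry a g by blast
    then have "mirror a y \<in> ?O" using g by (metis (no_types, lifting) comp_apply imageI)
    then have "mirror a y \<bullet> \<rho> \<le> y \<bullet> \<rho>" by (rule y)
    then have "0 \<le> 2 * (y \<bullet> a) / (a \<bullet> a) * (a \<bullet> \<rho>)" by (simp add: mirror_def inner_diff_left)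
    then show ?thesis using \<rho> aa by (simp add: zero_le_mult_iff zero_le_divide_iff)
  qed
  show thesis
    using that[OF g(1) _ _ _ expansion[of "g x"]] pos wall_v wall_e wall_f by (simp flip: g(2))
qed

lemma aff_dims: "aff_dim {0, v, e, f} = 3" "aff_dim {v, e, f} \<ge> 2" "aff_dim {v, e} \<ge> 1"
proof -
  have "span {0, v, e, f} = UNIV"
  proof -
    have "x \<in> span {0, v, e, f}" for x
      by (subst expansion[of x]) (intro span_add span_scale span_base; simp)
    then show ?thesis by blast
  qed
  then have "dim (span {0, v, e, f}) = dim (UNIV :: (real^3) set)" by simp
  then have "dim {0, v, e, f} = 3" by (simp add: dim_span del: span_insert_0)
  moreover have "aff_dim {0, v, e, f} = int (dim {0, v, e, f})"
    by (rule aff_dim_zero) (simp add: hull_inc)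
  ultimately show *: "aff_dim {0, v, e, f} = 3" by simp
  then show **: "aff_dim {v, e, f} \<ge> 2"
    using aff_dim_insert[of 0 "{v, e, f}"] by (simp split: if_splits)
  have "{v, e, f} = insert f {v, e}" by blast
  then show "aff_dim {v, e} \<ge> 1"
    using aff_dim_insert[of f "{v, e}"] ** by (simp split: if_splits)
qed

lemma aff_dim_P: "aff_dim P = 3"
proof -
  have "aff_dim {0, v, e, f} \<le> aff_dim P" by (rule aff_dim_subset) (use flag_in zero_in in auto)
  moreover have "aff_dim P \<le> 3" using aff_dim_le_DIM[of P] by simp
  ultimately show ?thesis using aff_dims by simp
qed

lemma face_with_f:
  assumes "D face_of P" "f \<in> D"
  shows "v \<in> D" "e \<in> D" "aff_dim D \<ge> 2"
proof -
  show ve: "v \<in> D" "e \<in> D"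
    using face_segments face_ofD[OF assms(1)] assms(2) flag_in by blast+
  then have "aff_dim {v, e, f} \<le> aff_dim D" using assms by (intro aff_dim_subset) auto
  then show "aff_dim D \<ge> 2" using aff_dims by linarith
qed

lemma face_with_e:
  assumes "D face_of P" "e \<in> D"
  shows "v \<in> D" "aff_dim D \<ge> 1"
proof -
  show ve: "v \<in> D"
    using edge_segment face_ofD[OF assms(1)] assms(2) flag_in by blast
  then have "aff_dim {v, e} \<le> aff_dim D" using assms by (intro aff_dim_subset) auto
  then show "aff_dim D \<ge> 1" using aff_dims by linarith
qed

text \<open>A face through the centre of symmetry contains both ends of every segment from \<open>x\<close> to \<open>- x\<close>.\<close>

lemma face_with_zero:
  assumes D: "D face_of P" "0 \<in> D"
  shows "aff_dim D = 3"
proof -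
  have "x \<in> D" if "x \<in> P" "x \<noteq> 0" for x
  proof -
    have "x \<noteq> - x"
    proof
      assume "x = - x"
      then have "2 *\<^sub>R x = 0" by (simp add: scaleR_2 eq_neg_iff_add_eq_0)
      with that show False by simp
    qed
    then have "midpoint x (- x) \<in> open_segment x (- x)" by simp
    then have "0 \<in> open_segment x (- x)" by (simp add: midpoint_def)
    then show ?thesis using face_ofD[OF D(1)] D(2) that antipodal by blast
  qed
  then have "D = P" using D face_of_imp_subset by blast
  then show ?thesis by (simp add: aff_dim_P)
qed

text \<open>The defining property of faces concerns open segments; this version also covers the degenerate
  cases \<open>t = 1\<close> and \<open>p = q\<close>.\<close>

lemma face_contains_part:
  assumes D: "D face_of P" and pq: "p \<in> P" "q \<in> P" and t: "0 < t" "t \<le> 1"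
    and mem: "t *\<^sub>R p + (1 - t) *\<^sub>R q \<in> D"
  shows "p \<in> D"
proof (cases "p = q \<or> t = 1")
  case True
  with mem show ?thesis by (auto simp flip: scaleR_add_left)
next
  case False
  then have "t *\<^sub>R p + (1 - t) *\<^sub>R q \<in> open_segment q p"
    using t by (auto simp: in_segment intro!: exI[of _ t])
  then show ?thesis using face_ofD[OF D] mem pq by blast
qed

text \<open>A relative interior point of \<open>D\<close>, moved into the chamber, is a nonnegative combination of \<open>v\<close>, \<open>e\<close>
  and \<open>f\<close>. The supporting plane bounds the sum of the weights by 1. If the sum were smaller, the
  moved point would lie strictly between 0 and another point of the polytope, or be 0 itself, and
  the face would contain 0.\<close>

lemma move_face:
  assumes D: "D face_of P" "D \<noteq> {}" "aff_dim D \<le> 2"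
  obtains g \<alpha> \<beta> \<gamma> where "g \<in> symmetries P" "\<alpha> \<ge> 0" "\<beta> \<ge> 0" "\<gamma> \<ge> 0" "\<alpha> + \<beta> + \<gamma> = 1"
    "\<alpha> *\<^sub>R v + \<beta> *\<^sub>R e + \<gamma> *\<^sub>R f \<in> rel_interior (g ` D)"
proof -
  have "rel_interior D \<noteq> {}" using D face_of_imp_convex rel_interior_eq_empty by blast
  then obtain x where x: "x \<in> rel_interior D" by blast
  then have "x \<in> P" using D face_of_imp_subset rel_interior_subset by blast
  then obtain g \<alpha> \<beta> \<gamma> where g: "g \<in> symmetries P" "\<alpha> \<ge> 0" "\<beta> \<ge> 0" "\<gamma> \<ge> 0"
    and gx: "g x = \<alpha> *\<^sub>R v + \<beta> *\<^sub>R e + \<gamma> *\<^sub>R f"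
    by (rule move_to_chamber)
  have face: "g ` D face_of P" "aff_dim (g ` D) \<le> 2" using symmetry_face[OF g(1) D(1)] D by auto
  have inD: "g x \<in> g ` D" using x rel_interior_subset by blast
  then have inP: "g x \<in> P" using face face_of_imp_subset by blast
  have ff: "f \<bullet> f > 0" using wall_f by auto
  define s where "s = \<alpha> + \<beta> + \<gamma>"
  have "f \<bullet> g x = s * (f \<bullet> f)"
    unfolding gx s_def by (simp add: inner_add_right support algebra_simps)
  then have "s \<le> 1" using support(1)[OF inP] ff by simp
  moreover have "\<not> s < 1"
  proof
    assume "s < 1"
    have "0 \<in> g ` D"
    proof (cases "s = 0")
      case True
      then have "g x = 0" using g gx by (simp add: s_def add_nonneg_eq_0_iff)
      with inD show ?thesis by simp
    next
      case False
      then have "s > 0" using g by (simp add: s_def)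
      have "(\<alpha> / s) *\<^sub>R v + (\<beta> / s) *\<^sub>R e + (\<gamma> / s) *\<^sub>R f \<in> convex hull {v, e, f}"
        unfolding convex_hull_3 using g \<open>s > 0\<close>
        by (force simp: s_def simp flip: add_divide_distrib)
      then have "g x /\<^sub>R s \<in> P"
        using hull_minimal[of "{v, e, f}" P convex] flag_in convex
        by (auto simp: gx scaleR_add_right divide_inverse mult.commute)
      moreover have "(1 - s) *\<^sub>R 0 + (1 - (1 - s)) *\<^sub>R (g x /\<^sub>R s) \<in> g ` D" using inD \<open>s > 0\<close> by simp
      ultimately show ?thesis
        using face_contains_part[OF face(1) zero_in, of "g x /\<^sub>R s" "1 - s"] \<open>s < 1\<close> \<open>s > 0\<close> by simp
    qed
    then show False using face_with_zero[OF face(1)] face(2) by simp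
  qed
  ultimately have "\<alpha> + \<beta> + \<gamma> = 1" by (simp add: s_def)
  moreover have "rel_interior (g ` D) = g ` rel_interior D"
    using symmetry_linear[OF g(1)] symmetry_inj[OF g(1)]
    by (intro rel_interior_injective_linear_image) (simp_all add: linear_conv_bounded_linear)
  then have "\<alpha> *\<^sub>R v + \<beta> *\<^sub>R e + \<gamma> *\<^sub>R f \<in> rel_interior (g ` D)"
    using x gx by (metis imageI)
  ultimately show thesis using that g by blast
qed

definition facet0 :: "(real^3) set" where
  "facet0 = P \<inter> {x. f \<bullet> x = f \<bullet> f}"

text \<open>The edge through \<open>v\<close> and \<open>e\<close>, as the intersection of the facet at \<open>f\<close> with its reflection in the
  wall that contains \<open>v\<close> and \<open>e\<close>.\<close>

definition edge0 :: "(real^3) set" where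
  "edge0 = facet0 \<inter> (P \<inter> {x. mirror a\<^sub>f f \<bullet> x = f \<bullet> f})"

lemma facet0: "facet0 face_of P" "aff_dim facet0 \<le> 2"
proof -
  show face: "facet0 face_of P"
    unfolding facet0_def using convex support by (intro face_of_Int_supporting_hyperplane_le) auto
  have "f \<bullet> f > 0" using wall_f by auto
  then have "0 \<notin> facet0" by (simp add: facet0_def)
  then have "facet0 \<noteq> P" using zero_in by blast
  then show "aff_dim facet0 \<le> 2" using face_of_aff_dim_lt[OF convex face] aff_dim_P by simp
qed

text \<open>The reflected facet misses \<open>f\<close>, so \<open>edge0\<close> is a proper face of \<open>facet0\<close>, which drops the dimension.\<close>

lemma edge0: "edge0 face_of P" "aff_dim edge0 \<le> 1"
proof -
  have le: "mirror a\<^sub>f f \<bullet> x \<le> f \<bullet> f" if "x \<in> P" for x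
    using support(1)[of "mirror a\<^sub>f x"] mirrors[of a\<^sub>f] that by (auto simp: mirror_self_adjoint)
  then show face: "edge0 face_of P"
    unfolding edge0_def using convex
    by (intro face_of_Int facet0 face_of_Int_supporting_hyperplane_le) auto
  have aa: "a\<^sub>f \<bullet> a\<^sub>f > 0" using wall_f by auto
  have "mirror a\<^sub>f f \<bullet> f = f \<bullet> f - 2 * (f \<bullet> a\<^sub>f) / (a\<^sub>f \<bullet> a\<^sub>f) * (f \<bullet> a\<^sub>f)"
    by (simp add: mirror_def inner_diff_left inner_diff_right inner_commute)
  also have "\<dots> < f \<bullet> f" using wall_f aa by simp
  finally have "f \<notin> edge0" by (simp add: edge0_def)
  moreover have "f \<in> facet0" by (simp add: facet0_def flag_in)
  moreover have "edge0 face_of facet0"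
    using face by (rule face_of_subset) (use facet0 face_of_imp_subset in \<open>auto simp: edge0_def\<close>)
  ultimately show "aff_dim edge0 \<le> 1"
    using face_of_aff_dim_lt[of facet0 edge0] facet0 face_of_imp_convex by fastforce
qed

lemma edge0_members: "v \<in> edge0" "e \<in> edge0"
proof -
  have "mirror a\<^sub>f f \<bullet> v = f \<bullet> f" "mirror a\<^sub>f f \<bullet> e = f \<bullet> f"
    by (simp_all add: mirror_self_adjoint mirror_fixed wall_f support)
  then show "v \<in> edge0" "e \<in> edge0" by (auto simp: edge0_def facet0_def flag_in support)
qed

definition flag_face :: "int \<Rightarrow> (real^3) set" where
  "flag_face d = (if d = 0 then {v} else if d = 1 then edge0 else facet0)"

text \<open>The weights of the moved relative interior point reflect the dimension of the face: a positive weight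
  at \<open>f\<close> puts \<open>v\<close>, \<open>e\<close> and \<open>f\<close> on the face, a positive weight at \<open>e\<close> puts \<open>v\<close> and \<open>e\<close> on it. So
  the point lies on the flag face of the same dimension. A face whose relative interior meets
  another face is contained in it, and equality of dimensions makes the two equal.\<close>

lemma move_to_flag:
  assumes D: "D face_of P" "aff_dim D = d" "d \<in> {0, 1, 2}"
  obtains g where "g \<in> symmetries P" "g ` D = flag_face d"
proof -
  have "D \<noteq> {}" "aff_dim D \<le> 2" using D by auto
  from move_face[OF D(1) this] obtain g \<alpha> \<beta> \<gamma>
    where g: "g \<in> symmetries P" and w: "\<alpha> \<ge> 0" "\<beta> \<ge> 0" "\<gamma> \<ge> 0" "\<alpha> + \<beta> + \<gamma> = 1"
      and rel: "\<alpha> *\<^sub>R v + \<beta> *\<^sub>R e + \<gamma> *\<^sub>R f \<in> rel_interior (g ` D)" .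
  let ?D = "g ` D"
  define x where "x = \<alpha> *\<^sub>R v + \<beta> *\<^sub>R e + \<gamma> *\<^sub>R f"
  have face: "?D face_of P" "aff_dim ?D = d" using symmetry_face[OF g D(1)] D(2) by auto
  have xD: "x \<in> ?D" using rel rel_interior_subset by (auto simp: x_def)
  have \<gamma>: "d = 2" if "\<gamma> > 0"
  proof -
    have "f \<in> ?D"
    proof (cases "\<gamma> = 1")
      case True
      then have "\<alpha> = 0" "\<beta> = 0" using w by auto
      with True xD show ?thesis by (simp add: x_def)
    next
      case False
      then have "1 - \<gamma> > 0" using w by auto
      define q where "q = (\<alpha> / (1 - \<gamma>)) *\<^sub>R v + (\<beta> / (1 - \<gamma>)) *\<^sub>R e"
      have "\<alpha> / (1 - \<gamma>) + \<beta> / (1 - \<gamma>) = (\<alpha> + \<beta>) / (1 - \<gamma>)" by (simp add: add_divide_distrib)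
      also have "\<dots> = 1" using w(4) \<open>1 - \<gamma> > 0\<close> by simp
      finally have "q \<in> P"
        unfolding q_def using flag_in w \<open>1 - \<gamma> > 0\<close> by (intro convexD[OF convex]) auto
      moreover have "x = \<gamma> *\<^sub>R f + (1 - \<gamma>) *\<^sub>R q"
        using \<open>1 - \<gamma> > 0\<close> by (simp add: q_def x_def scaleR_add_right)
      ultimately show ?thesis
        using face_contains_part[OF face(1) flag_in(3) _ that] xD w by simp
    qed
    then have "d \<ge> 2" using face_with_f[OF face(1)] face(2) by simp
    with D(3) show "d = 2" by auto
  qed
  have \<beta>: "d \<noteq> 0" if "\<beta> > 0"
  proof
    assume "d = 0"
    then have "\<gamma> = 0" using \<gamma> w by fastforce
    then have "\<alpha> = 1 - \<beta>" using w by simp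
    then have "\<beta> *\<^sub>R e + (1 - \<beta>) *\<^sub>R v \<in> ?D" using xD \<open>\<gamma> = 0\<close> by (simp add: x_def add.commute)
    then have "e \<in> ?D" using face_contains_part[OF face(1) flag_in(2,1) that] w by simp
    then show False using face_with_e[OF face(1)] face(2) \<open>d = 0\<close> by simp
  qed
  have flag: "x \<in> flag_face d" "flag_face d face_of P" "aff_dim (flag_face d) \<le> d"
  proof -
    consider "d = 0" | "d = 1" | "d = 2" using D(3) by auto
    then have "x \<in> flag_face d \<and> flag_face d face_of P \<and> aff_dim (flag_face d) \<le> d"
    proof cases
      case 1
      then have "\<gamma> = 0" "\<beta> = 0" using \<gamma> \<beta> w by fastforce+
      then have "x = v" using w by (simp add: x_def)
      with xD have "v \<in> ?D" by simp
      have "?D = {v}"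
      proof -
        have "aff_dim ?D = 0" using face 1 by simp
        then obtain a where "?D = {a}" using aff_dim_eq_0[of ?D] by metis
        with \<open>v \<in> ?D\<close> show ?thesis by auto
      qed
      with face \<open>x = v\<close> 1 show ?thesis by (simp add: flag_face_def)
    next
      case 2
      then have "\<gamma> = 0" using \<gamma> w by fastforce
      then have "x = \<alpha> *\<^sub>R v + \<beta> *\<^sub>R e" "\<alpha> + \<beta> = 1" using w by (simp_all add: x_def)
      then have "x \<in> edge0"
        using edge0_members w face_of_imp_convex[OF edge0(1)] convexD by metis
      with 2 edge0 show ?thesis by (simp add: flag_face_def)
    next
      case 3
      have "x \<in> P" using xD face face_of_imp_subset by blast
      moreover have "f \<bullet> x = (\<alpha> + \<beta> + \<gamma>) * (f \<bullet> f)"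
        by (simp add: x_def inner_add_right support algebra_simps)
      ultimately have "x \<in> facet0" using w by (simp add: facet0_def)
      with 3 facet0 show ?thesis by (simp add: flag_face_def)
    qed
    then show "x \<in> flag_face d" "flag_face d face_of P" "aff_dim (flag_face d) \<le> d" by auto
  qed
  have "?D \<subseteq> flag_face d"
    using subset_of_face_of[OF flag(2) face_of_imp_subset[OF face(1)]] flag(1) rel by (auto simp: x_def)
  then have "?D face_of flag_face d"
    using face(1) flag(2) face_of_subset face_of_imp_subset by blast
  then have "?D = flag_face d"
    using face_of_aff_dim_lt[OF face_of_imp_convex[OF flag(2)]] face(2) flag(3) by fastforce
  with g show thesis by (rule that)
qed

text \<open>These reflections turn an orientation-reversing symmetry between two faces into a rotation.\<close>

lemma mirror_fixing_flag:
  assumes "d \<in> {0, 1, 2}"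
  obtains a where "a \<in> {a\<^sub>v, a\<^sub>e, a\<^sub>f}" "mirror a ` flag_face d = flag_face d"
proof -
  consider "d = 0" | "d = 1" | "d = 2" using assms by auto
  then show thesis
  proof cases
    case 1
    then show thesis using that[of "a\<^sub>f"] wall_f by (simp add: flag_face_def mirror_fixed)
  next
    case 2
    have "mirror a\<^sub>f ` edge0 \<subseteq> edge0"
      using mirrors[of a\<^sub>f] by (auto simp: edge0_def facet0_def mirror_self_adjoint mirror_mirror simp flip: mirror_self_adjoint)
    then show thesis using that[of "a\<^sub>f"] mirror_image_eq 2 by (simp add: flag_face_def)
  next
    case 3
    have "f \<bullet> mirror a\<^sub>v x = f \<bullet> x" for x
      by (simp add: mirror_fixed wall_v flip: mirror_self_adjoint)
    then have "mirror a\<^sub>v ` facet0 \<subseteq> facet0"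
      using mirrors[of a\<^sub>v] by (auto simp: facet0_def)
    then show thesis using that[of "a\<^sub>v"] mirror_image_eq 3 by (simp add: flag_face_def)
  qed
qed

text \<open>Both faces are moved to the same flag face. If the resulting symmetry from \<open>D\<close> to \<open>D'\<close> reverses the
  orientation, a reflection that preserves the flag face is inserted in the middle.\<close>

theorem rotation_transitive_on_faces:
  assumes D: "D face_of P" "D' face_of P" "aff_dim D = d" "aff_dim D' = d" "d \<in> {0, 1, 2}"
  shows "\<exists>g\<in>symmetries P. det (matrix g) = 1 \<and> g ` D = D'"
proof -
  obtain g where g: "g \<in> symmetries P" "g ` D = flag_face d" using move_to_flag D by metis
  obtain h where h: "h \<in> symmetries P" "h ` D' = flag_face d" using move_to_flag D by metis
  obtain a where a: "a \<in> {a\<^sub>v, a\<^sub>e, a\<^sub>f}" "mirror a ` flag_face d = flag_face d"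
    using mirror_fixing_flag D(5) by blast
  have hinv: "inv h ` flag_face d = D'" using h symmetry_inj by (metis image_inv_f_f)
  \<comment> \<open>The two candidates have determinants of opposite sign.\<close>
  let ?k = "inv h \<circ> g" and ?l = "inv h \<circ> (mirror a \<circ> g)"
  have k: "?k \<in> symmetries P" "?k ` D = D'"
    using g h symmetries_comp symmetries_inv by (auto simp only: image_comp[symmetric] g(2) hinv)
  have l: "?l \<in> symmetries P" "?l ` D = D'"
    using g h a symmetries_comp symmetries_inv mirror_symmetry
    by (auto simp only: image_comp[symmetric] g(2) hinv a(2))
  have "a \<noteq> 0" using a wall_v wall_e wall_f by auto
  then have "det (matrix ?l) = - det (matrix ?k)"
    using symmetry_linear[OF g(1)] symmetry_linear[OF symmetries_inv[OF h(1)]] linear_mirror[of a]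
    by (simp add: matrix_compose linear_compose det_mul det_mirror)
  moreover have "det (matrix ?k) = 1 \<or> det (matrix ?k) = -1"
    using k(1) by (intro det_orthogonal_matrix) (simp add: symmetries_def orthogonal_transformation_matrix)
  ultimately have "det (matrix ?k) = 1 \<or> det (matrix ?l) = 1" by auto
  with k l show ?thesis by blast
qed

end

section \<open>Tetrahedral rotations\<close>

definition cyclic_shift :: "real^3 \<Rightarrow> real^3" where
  "cyclic_shift x = vector [x$2, x$3, x$1]"

definition flip_yz :: "real^3 \<Rightarrow> real^3" where
  "flip_yz x = vector [x$1, - x$2, - x$3]"

definition flip_xz :: "real^3 \<Rightarrow> real^3" where
  "flip_xz x = vector [- x$1, x$2, - x$3]"

lemma orthogonal_coordinate_rotations:
  "orthogonal_transformation cyclic_shift"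
  "orthogonal_transformation flip_yz"
  "orthogonal_transformation flip_xz"
  by (auto simp: orthogonal_transformation_def cyclic_shift_def flip_yz_def flip_xz_def
      inner_vec_def sum_3 vec_eq_iff forall_3 intro!: linearI)

lemma det_coordinate_rotations:
  "det (matrix cyclic_shift) = 1" "det (matrix flip_yz) = 1" "det (matrix flip_xz) = 1"
  by (simp_all add: det_3 matrix_def cyclic_shift_def flip_yz_def flip_xz_def axis_def)

definition rotations :: "(real^3) set \<Rightarrow> (real^3 \<Rightarrow> real^3) set" where
  "rotations P = {g \<in> symmetries P. det (matrix g) = 1}"

text \<open>The three maps generate the rotations of the regular tetrahedron inscribed in the cube
  \<open>[-1, 1]\<^sup>3\<close>.\<close>

definition tetrahedral :: "(real^3) set \<Rightarrow> bool" where
  "tetrahedral P \<longleftrightarrow> (\<forall>x\<in>P. cyclic_shift x \<in> P \<and> flip_yz x \<in> P \<and> flip_xz x \<in> P)"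

lemma rotations_comp:
  assumes "g \<in> rotations P" "h \<in> rotations P"
  shows "g \<circ> h \<in> rotations P"
proof -
  have "linear g" "linear h" using assms symmetry_linear by (auto simp: rotations_def)
  then show ?thesis using assms symmetries_comp by (simp add: rotations_def matrix_compose det_mul)
qed

lemma cyclic_shift_cubed: "cyclic_shift (cyclic_shift (cyclic_shift x)) = x"
  by (simp add: cyclic_shift_def vec_eq_iff forall_3)

lemma tetrahedral_rotations:
  assumes "tetrahedral P"
  shows "cyclic_shift \<in> rotations P" "flip_yz \<in> rotations P" "flip_xz \<in> rotations P"
proof -
  have flips: "flip_yz (flip_yz x) = x" "flip_xz (flip_xz x) = x" for x
    by (simp_all add: flip_yz_def flip_xz_def vec_eq_iff forall_3)
  have onto: "f ` P = P" if "f ` P \<subseteq> P" "h ` P \<subseteq> P" "\<And>x. f (h x) = x" for f h :: "real^3 \<Rightarrow> real^3"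
  proof
    show "P \<subseteq> f ` P"
    proof
      fix x assume "x \<in> P"
      then have "h x \<in> P" using that(2) by blast
      then show "x \<in> f ` P" using that(3)[of x] by (metis imageI)
    qed
  qed (rule that(1))
  have "cyclic_shift ` P = P"
    using assms by (intro onto[of _ "cyclic_shift \<circ> cyclic_shift"])
      (auto simp: cyclic_shift_cubed tetrahedral_def)
  moreover have "flip_yz ` P = P"
    using assms by (intro onto[of _ flip_yz]) (auto simp: flips tetrahedral_def)
  moreover have "flip_xz ` P = P"
    using assms by (intro onto[of _ flip_xz]) (auto simp: flips tetrahedral_def)
  ultimately show "cyclic_shift \<in> rotations P" "flip_yz \<in> rotations P" "flip_xz \<in> rotations P"
    by (simp_all add: rotations_def symmetries_def orthogonal_coordinate_rotations det_coordinate_rotations)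
qed

text \<open>The powers of the cyclic shift separate the images of \<open>x\<close> unless \<open>x\<close> lies on the axis of the shift,
  and then the two half turns move it to different places.\<close>

lemma tetrahedral_orbit:
  assumes "x \<noteq> 0" "tetrahedral P"
  shows "\<exists>g\<in>rotations P. \<exists>h\<in>rotations P. card {x, g x, h x} = 3"
proof (cases "cyclic_shift x = x")
  case True
  have "cyclic_shift x $ 1 = x$2" "cyclic_shift x $ 3 = x$1" by (simp_all add: cyclic_shift_def)
  then have "x$2 = x$1" "x$3 = x$1" unfolding True by simp_all
  then have eq: "x = vector [x$1, x$1, x$1]" by (simp add: vec_eq_iff forall_3)
  have "x = 0" if "x$1 = 0" by (subst eq) (simp add: that vec_eq_iff forall_3)
  with assms(1) have "x$1 \<noteq> 0" by blast
  then have "x \<noteq> flip_yz x" "x \<noteq> flip_xz x" "flip_yz x \<noteq> flip_xz x"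
    by (subst (1 2) eq, simp add: flip_yz_def flip_xz_def vec_eq_iff forall_3)+
  then have "card {x, flip_yz x, flip_xz x} = 3" by simp
  then show ?thesis using tetrahedral_rotations[OF assms(2)] by blast
next
  case False
  let ?c = cyclic_shift
  have "?c (?c x) \<noteq> x" "?c (?c x) \<noteq> ?c x" using False cyclic_shift_cubed by metis+
  then have "card {x, ?c x, (?c \<circ> ?c) x} = 3" using False by auto
  then show ?thesis using tetrahedral_rotations[OF assms(2)] rotations_comp by blast
qed

section \<open>The cube\<close>

lemma reflection_polytope_cube:
  "reflection_polytope (cbox (-1) 1) (vector [1, 1, 1]) (vector [1, 1, 0]) (vector [1, 0, 0])
     (vector [0, 0, 1]) (vector [0, 1, -1]) (vector [1, -1, 0])"
proof
  show "polytope (cbox (-1) (1 :: real^3))" by (rule polytope_interval)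
  show "- x \<in> cbox (-1) 1" if "x \<in> cbox (-1) 1" for x :: "real^3"
    using that by (simp add: mem_box_cart forall_3)
  show "mirror a ` cbox (-1) 1 = cbox (-1) 1"
    if "a \<in> {vector [0, 0, 1], vector [0, 1, -1], vector [1, -1, 0]}" for a
    using that by (intro mirror_image_eq) (auto simp: mem_box_cart forall_3 mirror_components diff_divide_distrib)
  show "x = (x \<bullet> (vector [0, 0, 1] :: real^3) / ((vector [1, 1, 1] :: real^3) \<bullet> (vector [0, 0, 1] :: real^3))) *\<^sub>R (vector [1, 1, 1] :: real^3)
      + (x \<bullet> (vector [0, 1, -1] :: real^3) / ((vector [1, 1, 0] :: real^3) \<bullet> (vector [0, 1, -1] :: real^3))) *\<^sub>R (vector [1, 1, 0] :: real^3)
      + (x \<bullet> (vector [1, -1, 0] :: real^3) / ((vector [1, 0, 0] :: real^3) \<bullet> (vector [1, -1, 0] :: real^3))) *\<^sub>R (vector [1, 0, 0] :: real^3)"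
    for x :: "real^3"
    by (simp add: vec_eq_iff forall_3 inner_vec_def sum_3)
  have mid: "\<exists>w\<in>cbox (-1) 1. p \<in> open_segment q w"
    if "midpoint q w = p" "w \<in> cbox (-1) 1" "q \<noteq> w" for p q w :: "real^3"
    using that midpoint_in_open_segment[of q w] by metis
  show "\<exists>w\<in>cbox (-1) 1. vector [1, 1, 0] \<in> open_segment (vector [1, 1, 1] :: real^3) w"
    by (rule mid[of _ "vector [1, 1, -1]"])
      (simp_all add: midpoint_def vec_eq_iff forall_3 mem_box_cart)
  show "\<exists>w\<in>cbox (-1) 1. vector [1, 0, 0] \<in> open_segment (vector [1, 1, 1] :: real^3) w"
    by (rule mid[of _ "vector [1, -1, -1]"])
      (simp_all add: midpoint_def vec_eq_iff forall_3 mem_box_cart)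
  show "\<exists>w\<in>cbox (-1) 1. vector [1, 0, 0] \<in> open_segment (vector [1, 1, 0] :: real^3) w"
    by (rule mid[of _ "vector [1, -1, 0]"])
      (simp_all add: midpoint_def vec_eq_iff forall_3 mem_box_cart)
qed (simp_all add: inner_vec_def sum_3 mem_box_cart forall_3)

lemma tetrahedral_cube: "tetrahedral (cbox (-1) 1)"
  by (simp add: tetrahedral_def mem_box_cart forall_3 cyclic_shift_def flip_yz_def flip_xz_def)

text \<open>The two walls through the face centre meet at an angle of \<open>\<pi>/4\<close>, so the product of their
  reflections is a quarter turn.\<close>

lemma cube_rotation_order:
  defines "g \<equiv> mirror (vector [0, 1, -1]) \<circ> mirror (vector [0, 0, 1])"
  shows "g ^^ 4 = id" "g \<circ> g \<noteq> id"
proof -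
  have g: "g x = vector [x$1, - x$3, x$2]" for x
    by (simp add: g_def vec_eq_iff forall_3 mirror_components diff_divide_distrib add_divide_distrib)
  show "g ^^ 4 = id"
    by (simp add: fun_eq_iff numeral_eq_Suc g vec_eq_iff forall_3)
  have "(g \<circ> g) (vector [0, 1, 0]) \<noteq> id (vector [0, 1, 0])"
    by (simp add: g vec_eq_iff forall_3)
  then show "g \<circ> g \<noteq> id" by metis
qed

section \<open>The regular dodecahedron\<close>

lemma golden_ratio_eq: "golden_ratio * golden_ratio = golden_ratio + 1"
  and golden_ratio_bounds: "1 < golden_ratio" "golden_ratio < 2"
proof -
  have "1 < sqrt 5" "sqrt 5 < 3" by (simp_all add: real_less_rsqrt real_less_lsqrt)
  then show "1 < golden_ratio" "golden_ratio < 2" by (simp_all add: golden_ratio_def)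
  have "(1 + sqrt 5) * (1 + sqrt 5) = 6 + 2 * sqrt 5" by (simp add: algebra_simps)
  then show "golden_ratio * golden_ratio = golden_ratio + 1"
    unfolding golden_ratio_def by (simp add: field_simps)
qed

lemma inverse_golden_ratio: "t / golden_ratio = t * (golden_ratio - 1)"
proof -
  have "golden_ratio * (golden_ratio - 1) = 1" using golden_ratio_eq by (simp add: algebra_simps)
  then have "1 / golden_ratio = golden_ratio - 1"
    using golden_ratio_bounds by (metis less_irrefl less_trans nonzero_mult_div_cancel_left zero_less_one)
  then show ?thesis by (metis divide_inverse mult_1)
qed

definition dodecahedron_vertices :: "(real^3) set" where
  "dodecahedron_vertices = {x.
     \<bar>x$1\<bar> = 1 \<and> \<bar>x$2\<bar> = 1 \<and> \<bar>x$3\<bar> = 1 \<or>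
     x$1 = 0 \<and> \<bar>x$2\<bar> = golden_ratio - 1 \<and> \<bar>x$3\<bar> = golden_ratio \<or>
     \<bar>x$1\<bar> = golden_ratio - 1 \<and> \<bar>x$2\<bar> = golden_ratio \<and> x$3 = 0 \<or>
     \<bar>x$1\<bar> = golden_ratio \<and> x$2 = 0 \<and> \<bar>x$3\<bar> = golden_ratio - 1}"

lemma vec3_eq_vector_iff: "x = vector [a, b, c] \<longleftrightarrow> x$1 = a \<and> x$2 = b \<and> x$3 = c"
  for x :: "real^3"
  by (simp add: vec_eq_iff forall_3)

text \<open>Absolute values absorb the choices of signs, and \<open>1/\<phi> = \<phi> - 1\<close>.\<close>

lemma standard_dodecahedron_hull: "standard_dodecahedron = convex hull dodecahedron_vertices"
proof -
  let ?pm = "{-1, 1 :: real}"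
  have sign: "\<bar>y\<bar> = t \<longleftrightarrow> (\<exists>a\<in>?pm. y = a * t)" if "0 \<le> t" for y t :: real
    using that by auto
  have pos: "0 \<le> golden_ratio - 1" "0 \<le> golden_ratio" using golden_ratio_bounds by auto
  have "x \<in> {vector [a, b, c] | a b c. a \<in> ?pm \<and> b \<in> ?pm \<and> c \<in> ?pm}
      \<longleftrightarrow> \<bar>x$1\<bar> = 1 \<and> \<bar>x$2\<bar> = 1 \<and> \<bar>x$3\<bar> = 1" for x :: "real^3"
    by (simp add: vec3_eq_vector_iff) (auto simp: abs_if)
  moreover have "x \<in> {vector [0, a / golden_ratio, b * golden_ratio] | a b. a \<in> ?pm \<and> b \<in> ?pm}
      \<longleftrightarrow> x$1 = 0 \<and> \<bar>x$2\<bar> = golden_ratio - 1 \<and> \<bar>x$3\<bar> = golden_ratio" for x :: "real^3"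
    unfolding inverse_golden_ratio sign[OF pos(1)] sign[OF pos(2)] mem_Collect_eq vec3_eq_vector_iff by blast
  moreover have "x \<in> {vector [a / golden_ratio, b * golden_ratio, 0] | a b. a \<in> ?pm \<and> b \<in> ?pm}
      \<longleftrightarrow> \<bar>x$1\<bar> = golden_ratio - 1 \<and> \<bar>x$2\<bar> = golden_ratio \<and> x$3 = 0" for x :: "real^3"
    unfolding inverse_golden_ratio sign[OF pos(1)] sign[OF pos(2)] mem_Collect_eq vec3_eq_vector_iff by blast
  moreover have "x \<in> {vector [b * golden_ratio, 0, a / golden_ratio] | a b. a \<in> ?pm \<and> b \<in> ?pm}
      \<longleftrightarrow> \<bar>x$1\<bar> = golden_ratio \<and> x$2 = 0 \<and> \<bar>x$3\<bar> = golden_ratio - 1" for x :: "real^3"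
    unfolding inverse_golden_ratio sign[OF pos(1)] sign[OF pos(2)] mem_Collect_eq vec3_eq_vector_iff by blast
  ultimately show ?thesis
    unfolding standard_dodecahedron_def dodecahedron_vertices_def Let_def
    by (intro arg_cong[where f = "(hull) convex"] Set.set_eqI) (simp only: Un_iff mem_Collect_eq disj_assoc)
qed

lemma finite_dodecahedron_vertices: "finite dodecahedron_vertices"
proof (rule finite_subset)
  let ?F = "{0, 1, -1, golden_ratio, - golden_ratio, golden_ratio - 1, 1 - golden_ratio}"
  show "dodecahedron_vertices \<subseteq> (\<lambda>(a, b, c). vector [a, b, c]) ` (?F \<times> ?F \<times> ?F)"
  proof
    fix x assume x: "x \<in> dodecahedron_vertices"
    have "x$1 \<in> ?F \<and> x$2 \<in> ?F \<and> x$3 \<in> ?F"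
      using x unfolding dodecahedron_vertices_def Let_def mem_Collect_eq insert_iff by linarith
    moreover have "x = (\<lambda>(a, b, c). vector [a, b, c]) (x$1, x$2, x$3)"
      by (simp add: vec_eq_iff forall_3)
    ultimately show "x \<in> (\<lambda>(a, b, c). vector [a, b, c]) ` (?F \<times> ?F \<times> ?F)" by blast
  qed
qed simp

lemma image_hull_eq:
  assumes "linear g" "inj g" "g ` A \<subseteq> A" "finite A"
  shows "g ` (convex hull A) = convex hull A"
proof -
  have "g ` A = A" using assms by (intro endo_inj_surj) (auto intro: inj_on_subset)
  then show ?thesis using convex_hull_linear_image[OF assms(1), of A] by simp
qed

text \<open>A normal of the plane spanned by the vertex \<open>(0, 1/\<phi>, \<phi>)\<close> and the direction \<open>(1, 0, \<phi>)\<close> of a face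
  centre: the negative of their cross product.\<close>

definition golden_mirror :: "real^3" where
  "golden_mirror = vector [-1, - golden_ratio, golden_ratio - 1]"

lemma golden_mirror_components:
  fixes x :: "real^3"
  defines "y \<equiv> mirror golden_mirror x" and "\<phi> \<equiv> golden_ratio"
  shows "y$1 = (x$1 - \<phi> * x$2 + (\<phi> - 1) * x$3) / 2"
    "y$2 = (- \<phi> * x$1 + (1 - \<phi>) * x$2 + x$3) / 2"
    "y$3 = ((\<phi> - 1) * x$1 + x$2 + \<phi> * x$3) / 2"
proof -
  have \<phi>: "\<phi> * \<phi> = \<phi> + 1" using golden_ratio_eq by (simp add: \<phi>_def)
  have "(golden_mirror$1)\<^sup>2 + (golden_mirror$2)\<^sup>2 + (golden_mirror$3)\<^sup>2 = 4"
    using \<phi> by (simp add: golden_mirror_def power2_eq_square algebra_simps flip: \<phi>_def)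
  then have y: "y $ i = x$i - (x$1 * golden_mirror$1 + x$2 * golden_mirror$2 + x$3 * golden_mirror$3)
      / 2 * golden_mirror$i" for i
    by (simp add: y_def mirror_components)
  show "y$1 = (x$1 - \<phi> * x$2 + (\<phi> - 1) * x$3) / 2"
    "y$2 = (- \<phi> * x$1 + (1 - \<phi>) * x$2 + x$3) / 2"
    "y$3 = ((\<phi> - 1) * x$1 + x$2 + \<phi> * x$3) / 2"
    unfolding y golden_mirror_def \<phi>_def[symmetric] using \<phi>
    by (simp_all, Groebner_Basis.algebra+)
qed

lemma mem_dodecahedron_vertices:
  "x \<in> dodecahedron_vertices \<longleftrightarrow>
     \<bar>x$1\<bar> = 1 \<and> \<bar>x$2\<bar> = 1 \<and> \<bar>x$3\<bar> = 1 \<or>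
     x$1 = 0 \<and> \<bar>x$2\<bar> = golden_ratio - 1 \<and> \<bar>x$3\<bar> = golden_ratio \<or>
     \<bar>x$1\<bar> = golden_ratio - 1 \<and> \<bar>x$2\<bar> = golden_ratio \<and> x$3 = 0 \<or>
     \<bar>x$1\<bar> = golden_ratio \<and> x$2 = 0 \<and> \<bar>x$3\<bar> = golden_ratio - 1"
  by (simp add: dodecahedron_vertices_def Let_def)

lemma golden_mirror_vertices:
  assumes "x \<in> dodecahedron_vertices"
  shows "mirror golden_mirror x \<in> dodecahedron_vertices"
proof -
  let ?g = golden_ratio
  \<comment> \<open>With these products every coordinate takes the form \<open>a + b \<phi>\<close>, and \<open>1 < \<phi> < 2\<close> settles the signs.\<close>
  have prods: "?g * ?g = ?g + 1" "?g * (?g - 1) = 1" "?g * (1 - ?g) = - 1"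
    "(?g - 1) * (?g - 1) = 2 - ?g" "(?g - 1) * ?g = 1" "(1 - ?g) * (?g - 1) = ?g - 2"
    "(?g - 1) * (1 - ?g) = ?g - 2" "(1 - ?g) * (1 - ?g) = 2 - ?g" "(1 - ?g) * ?g = - 1"
    using golden_ratio_eq by (simp_all add: algebra_simps)
  note b = golden_ratio_bounds
  have abs_cases: "y = t \<or> y = - t" if "\<bar>y\<bar> = t" for y t :: real
    using that by auto
  consider "\<bar>x$1\<bar> = 1" "\<bar>x$2\<bar> = 1" "\<bar>x$3\<bar> = 1"
    | "x$1 = 0" "\<bar>x$2\<bar> = ?g - 1" "\<bar>x$3\<bar> = ?g"
    | "\<bar>x$1\<bar> = ?g - 1" "\<bar>x$2\<bar> = ?g" "x$3 = 0"
    | "\<bar>x$1\<bar> = ?g" "x$2 = 0" "\<bar>x$3\<bar> = ?g - 1"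
    using assms unfolding mem_dodecahedron_vertices by blast
  then show ?thesis
  proof cases
    case 1
    from 1[THEN abs_cases] b show ?thesis
      unfolding mem_dodecahedron_vertices golden_mirror_components
      by (elim disjE) (simp_all add: prods)
  next
    case 2
    from 2(2,3)[THEN abs_cases] 2(1) b show ?thesis
      unfolding mem_dodecahedron_vertices golden_mirror_components
      by (elim disjE) (simp_all add: prods)
  next
    case 3
    from 3(1,2)[THEN abs_cases] 3(3) b show ?thesis
      unfolding mem_dodecahedron_vertices golden_mirror_components
      by (elim disjE) (simp_all add: prods)
  next
    case 4
    from 4(1,3)[THEN abs_cases] 4(2) b show ?thesis
      unfolding mem_dodecahedron_vertices golden_mirror_components
      by (elim disjE) (simp_all add: prods)
  qed
qed

lemma dodecahedron_mirrors:
  assumes "a \<in> {vector [0, 1, 0], golden_mirror, vector [1, 0, 0]}"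
  shows "mirror a ` standard_dodecahedron = standard_dodecahedron"
  unfolding standard_dodecahedron_hull
proof (rule image_hull_eq)
  show "linear (mirror a)" "finite dodecahedron_vertices"
    by (rule linear_mirror finite_dodecahedron_vertices)+
  show "inj (mirror a)" using mirror_mirror by (metis injI)
  show "mirror a ` dodecahedron_vertices \<subseteq> dodecahedron_vertices"
    using assms golden_mirror_vertices by (auto simp: mem_dodecahedron_vertices mirror_components)
qed

lemma tetrahedral_dodecahedron: "tetrahedral standard_dodecahedron"
proof -
  have hull: "g x \<in> standard_dodecahedron"
    if g: "linear g" "g ` dodecahedron_vertices \<subseteq> dodecahedron_vertices" and x: "x \<in> standard_dodecahedron"
    for g x
  proof -
    have "g ` (convex hull dodecahedron_vertices) \<subseteq> convex hull dodecahedron_vertices"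
      using hull_mono[OF g(2), of convex] by (simp only: convex_hull_linear_image[OF g(1)])
    then show ?thesis using x unfolding standard_dodecahedron_hull by (rule subsetD[OF _ imageI])
  qed
  have lin: "linear cyclic_shift" "linear flip_yz" "linear flip_xz"
    using orthogonal_coordinate_rotations by (simp_all add: orthogonal_transformation_def)
  have stable: "cyclic_shift ` dodecahedron_vertices \<subseteq> dodecahedron_vertices"
    "flip_yz ` dodecahedron_vertices \<subseteq> dodecahedron_vertices"
    "flip_xz ` dodecahedron_vertices \<subseteq> dodecahedron_vertices"
    by (auto simp: mem_dodecahedron_vertices cyclic_shift_def flip_yz_def flip_xz_def)
  show ?thesis
    unfolding tetrahedral_def
    using hull[OF lin(1) stable(1)] hull[OF lin(2) stable(2)] hull[OF lin(3) stable(3)] by blast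
qed

text \<open>Here \<open>f\<close> is the centre of the pentagon with the vertices \<open>(0, \<plusminus>1/\<phi>, \<phi>)\<close>, \<open>(1, \<plusminus>1, 1)\<close> and
  \<open>(\<phi>, 0, 1/\<phi>)\<close>, and \<open>e\<close> is the midpoint of its edge between the first two. Quotients such as
  \<open>\<phi>\<^sup>2/(\<phi> + 2)\<close> are written as \<open>(\<phi> + 2)/5\<close>, so that all identities are polynomial and follow from
  \<open>\<phi>\<^sup>2 = \<phi> + 1\<close>.\<close>

lemma reflection_polytope_dodecahedron:
  fixes \<phi> :: real
  defines "\<phi> \<equiv> golden_ratio"
  shows "reflection_polytope standard_dodecahedron
     (vector [0, \<phi> - 1, \<phi>]) (vector [0, 0, \<phi>]) (vector [(\<phi> + 2) / 5, 0, (3 * \<phi> + 1) / 5])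
     (vector [0, 1, 0]) golden_mirror (vector [1, 0, 0])"
proof -
  define v e f :: "real^3" where "v = vector [0, \<phi> - 1, \<phi>]" and "e = vector [0, 0, \<phi>]"
    and "f = vector [(\<phi> + 2) / 5, 0, (3 * \<phi> + 1) / 5]"
  define a b c :: "real^3" where "a = vector [0, 1, 0]" and "b = golden_mirror" and "c = vector [1, 0, 0]"
  note defs = v_def e_def f_def a_def b_def c_def golden_mirror_def
  let ?P = standard_dodecahedron
  have \<phi>: "\<phi> * \<phi> = \<phi> + 1" "1 < \<phi>" "\<phi> < 2"
    using golden_ratio_eq golden_ratio_bounds by (simp_all add: \<phi>_def)
  have \<phi>': "\<phi> * (\<phi> * t) = \<phi> * t + t" for t
    using \<phi>(1) by (metis distrib_right mult.assoc mult_1)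
  note phi = \<phi>(1) \<phi>'
  have phi1: "\<phi> * (\<phi> - 1) = 1" using \<phi>(1) by (simp add: algebra_simps)
  have inner: "x \<bullet> y = x$1 * y$1 + x$2 * y$2 + x$3 * y$3" for x y :: "real^3"
    by (simp add: inner_vec_def sum_3)
  have vertex: "x \<in> ?P" if "x \<in> dodecahedron_vertices" for x
    using that unfolding standard_dodecahedron_hull by (rule hull_inc)
  have convex: "convex ?P" unfolding standard_dodecahedron_hull by (rule convex_convex_hull)
  have mid: "midpoint x y \<in> ?P" if "x \<in> dodecahedron_vertices" "y \<in> dodecahedron_vertices" for x y
    using convex vertex that by (metis convex_contains_segment midpoint_in_closed_segment subsetD)
  have face: "f \<bullet> x \<le> f \<bullet> f" if "x \<in> ?P" for x
  proof -
    have ff: "f \<bullet> f = (4 * \<phi> + 3) / 5"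
      unfolding inner defs vector_3 by (simp add: field_simps phi)
    have "f \<bullet> y \<le> (4 * \<phi> + 3) / 5" if y: "y \<in> dodecahedron_vertices" for y
    proof -
      have fy: "f \<bullet> y = (\<phi> + 2) / 5 * (y$1 + \<phi> * y$3)"
        unfolding inner defs vector_3 by (simp add: field_simps phi)
      have "y$1 + \<phi> * y$3 \<le> \<bar>y$1\<bar> + \<phi> * \<bar>y$3\<bar>"
        using \<phi> by (intro add_mono mult_left_mono) auto
      also have "\<dots> \<le> \<phi> + 1"
        using y \<phi>(2,3) unfolding mem_dodecahedron_vertices \<phi>_def[symmetric]
        by (elim disjE conjE) (simp_all add: phi phi1)
      finally have "(\<phi> + 2) / 5 * (y$1 + \<phi> * y$3) \<le> (\<phi> + 2) / 5 * (\<phi> + 1)"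
        using \<phi> by (intro mult_left_mono) auto
      also have "\<dots> = (4 * \<phi> + 3) / 5" by (simp add: field_simps phi)
      finally show ?thesis unfolding fy .
    qed
    then have "?P \<subseteq> {x. f \<bullet> x \<le> (4 * \<phi> + 3) / 5}"
      unfolding standard_dodecahedron_hull by (intro hull_minimal convex_halfspace_le) auto
    with that ff show ?thesis by auto
  qed
  have segment: "\<exists>w\<in>?P. p \<in> open_segment q w"
    if "w \<in> ?P" "p = (1 - u) *\<^sub>R q + u *\<^sub>R w" "0 < u" "u < 1" "q \<noteq> w" for p q w :: "real^3" and u
    using that by (auto simp: in_segment)
  have "reflection_polytope ?P v e f a b c"
  proof
    show "polytope ?P"
      unfolding standard_dodecahedron_hull using finite_dodecahedron_vertices by (rule polytope_convex_hull)
    show "- x \<in> ?P" if "x \<in> ?P" for x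
    proof -
      have "uminus ` ?P = ?P"
        unfolding standard_dodecahedron_hull
        by (rule image_hull_eq[OF linear_uminus _ _ finite_dodecahedron_vertices])
          (auto simp: mem_dodecahedron_vertices)
      with that show ?thesis by blast
    qed
    show "mirror x ` ?P = ?P" if "x \<in> {a, b, c}" for x
      using that dodecahedron_mirrors by (auto simp: a_def b_def c_def)
    show "v \<bullet> a > 0" "e \<bullet> a = 0" "f \<bullet> a = 0" "e \<bullet> b > 0"
      "v \<bullet> c = 0" "e \<bullet> c = 0" "f \<bullet> c > 0"
      using \<phi> by (simp_all add: inner defs flip: \<phi>_def)
    show "v \<bullet> b = 0" "f \<bullet> b = 0"
      unfolding inner defs \<phi>_def[symmetric] vector_3 by (simp_all add: field_simps phi)
    show "x = (x \<bullet> a / (v \<bullet> a)) *\<^sub>R v + (x \<bullet> b / (e \<bullet> b)) *\<^sub>R e + (x \<bullet> c / (f \<bullet> c)) *\<^sub>R f" for x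
    proof -
      have d: "v \<bullet> a = \<phi> - 1" "e \<bullet> b = 1" "f \<bullet> c = (\<phi> + 2) / 5"
        unfolding inner defs \<phi>_def[symmetric] using \<phi>(1) by (simp_all add: algebra_simps)
      have q: "t / (\<phi> - 1) = t * \<phi>" "t / ((\<phi> + 2) / 5) = t * (3 - \<phi>)" for t
      proof -
        have "(3 - \<phi>) * (\<phi> + 2) = 5" by (simp add: algebra_simps phi)
        then have "t * 5 = t * (3 - \<phi>) * (\<phi> + 2)" by (simp only: mult.assoc)
        then show "t / ((\<phi> + 2) / 5) = t * (3 - \<phi>)" using \<phi>(2) by (simp add: divide_eq_eq)
        show "t / (\<phi> - 1) = t * \<phi>" using \<phi>(2) by (simp add: divide_eq_eq mult.assoc phi1)
      qed
      show ?thesis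
        unfolding d q unfolding inner vec_eq_iff forall_3
        by (simp add: defs field_simps phi flip: \<phi>_def)
    qed
    show "v \<in> ?P" using \<phi> by (intro vertex) (simp add: mem_dodecahedron_vertices v_def flip: \<phi>_def)
    have "midpoint v (vector [0, 1 - \<phi>, \<phi>]) = e" by (simp add: midpoint_def vec_eq_iff forall_3 defs)
    moreover have "midpoint v (vector [0, 1 - \<phi>, \<phi>]) \<in> ?P"
      using \<phi> by (intro mid) (simp_all add: mem_dodecahedron_vertices v_def flip: \<phi>_def)
    ultimately have "e \<in> ?P" by simp
    then show "e \<in> ?P" .
    have "f = (1 - (2 * \<phi> - 1) / 5) *\<^sub>R e + ((2 * \<phi> - 1) / 5) *\<^sub>R vector [\<phi>, 0, \<phi> - 1]"
      unfolding vec_eq_iff forall_3 by (simp add: defs field_simps phi)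
    moreover have "vector [\<phi>, 0, \<phi> - 1] \<in> ?P"
      using \<phi> by (intro vertex) (simp add: mem_dodecahedron_vertices flip: \<phi>_def)
    ultimately show "f \<in> ?P"
      using \<open>e \<in> ?P\<close> \<phi> by (auto intro!: convexD[OF convex])
    show "f \<bullet> x \<le> f \<bullet> f" if "x \<in> ?P" for x using that by (rule face)
    show "f \<bullet> v = f \<bullet> f" "f \<bullet> e = f \<bullet> f"
      unfolding inner defs vector_3 by (simp_all add: field_simps phi)
    show "\<exists>w\<in>?P. e \<in> open_segment v w"
    proof (rule segment)
      show "vector [0, 1 - \<phi>, \<phi>] \<in> ?P"
        using \<phi> by (intro vertex) (simp add: mem_dodecahedron_vertices flip: \<phi>_def)
      show "e = (1 - 1/2) *\<^sub>R v + (1/2) *\<^sub>R vector [0, 1 - \<phi>, \<phi>]"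
        by (simp add: vec_eq_iff forall_3 defs field_simps)
      show "v \<noteq> vector [0, 1 - \<phi>, \<phi>]" using \<phi> by (simp add: vec_eq_iff forall_3 defs)
    qed simp_all
    show "\<exists>w\<in>?P. f \<in> open_segment v w"
    proof (rule segment)
      show "midpoint (vector [1, -1, 1]) (vector [\<phi>, 0, \<phi> - 1]) \<in> ?P"
        using \<phi> by (intro mid) (simp_all add: mem_dodecahedron_vertices flip: \<phi>_def)
      show "f = (1 - 2 * (3 - \<phi>) / 5) *\<^sub>R v
          + (2 * (3 - \<phi>) / 5) *\<^sub>R midpoint (vector [1, -1, 1]) (vector [\<phi>, 0, \<phi> - 1])"
        unfolding vec_eq_iff forall_3 by (simp add: midpoint_def defs field_simps phi)
      have "midpoint (vector [1, -1, 1]) (vector [\<phi>, 0, \<phi> - 1] :: real^3) $ 2 \<noteq> v $ 2"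
        using \<phi> by (simp add: midpoint_def defs)
      then show "v \<noteq> midpoint (vector [1, -1, 1]) (vector [\<phi>, 0, \<phi> - 1])" by metis
    qed (use \<phi> in simp_all)
    show "\<exists>w\<in>?P. f \<in> open_segment e w"
    proof (rule segment)
      show "vector [\<phi>, 0, \<phi> - 1] \<in> ?P"
        using \<phi> by (intro vertex) (simp add: mem_dodecahedron_vertices flip: \<phi>_def)
      show "f = (1 - (2 * \<phi> - 1) / 5) *\<^sub>R e + ((2 * \<phi> - 1) / 5) *\<^sub>R vector [\<phi>, 0, \<phi> - 1]"
        unfolding vec_eq_iff forall_3 by (simp add: defs field_simps phi)
      show "e \<noteq> vector [\<phi>, 0, \<phi> - 1]" using \<phi> by (simp add: vec_eq_iff forall_3 defs)
    qed (use \<phi> in simp_all)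
  qed
  then show ?thesis unfolding v_def e_def f_def a_def b_def c_def .
qed

text \<open>The two walls through the face centre meet at an angle of \<open>\<pi>/5\<close>, so the product of their
  reflections is a fifth of a full turn. Its powers are computed with coefficients in \<open>\<int>[\<phi>]/2\<close>.\<close>

lemma dodecahedron_rotation_order:
  defines "g \<equiv> mirror golden_mirror \<circ> mirror (vector [0, 1, 0])"
  shows "g ^^ 5 = id" "g \<circ> g \<noteq> id"
proof -
  let ?g = golden_ratio
  have \<phi>': "?g * (?g * t) = ?g * t + t" for t
    using golden_ratio_eq by (metis distrib_right mult.assoc mult_1)
  note phi = golden_ratio_eq \<phi>'
  have flip: "mirror (vector [0, 1, 0]) x $ 1 = x$1" "mirror (vector [0, 1, 0]) x $ 2 = - x$2"
    "mirror (vector [0, 1, 0]) x $ 3 = x$3" for x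
    by (simp_all add: mirror_components)
  have g: "g x $ 1 = (x$1 + ?g * x$2 + (?g - 1) * x$3) / 2"
    "g x $ 2 = (- ?g * x$1 + (?g - 1) * x$2 + x$3) / 2"
    "g x $ 3 = ((?g - 1) * x$1 - x$2 + ?g * x$3) / 2" for x
    by (simp_all add: g_def golden_mirror_components flip algebra_simps)
  have gg: "g (g x) $ 1 = ((1 - ?g) * x$1 + x$2 + ?g * x$3) / 2"
    "g (g x) $ 2 = (- x$1 - ?g * x$2 + (?g - 1) * x$3) / 2"
    "g (g x) $ 3 = (?g * x$1 + (1 - ?g) * x$2 + x$3) / 2" for x
    unfolding g by (simp_all add: field_simps phi)
  have g4: "g (g (g (g x))) $ 1 = (x$1 - ?g * x$2 + (?g - 1) * x$3) / 2"
    "g (g (g (g x))) $ 2 = (?g * x$1 + (?g - 1) * x$2 - x$3) / 2"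
    "g (g (g (g x))) $ 3 = ((?g - 1) * x$1 + x$2 + ?g * x$3) / 2" for x
    unfolding gg by (simp_all add: field_simps phi)
  have g5: "g (g (g (g (g x)))) $ 1 = x$1" "g (g (g (g (g x)))) $ 2 = x$2" "g (g (g (g (g x)))) $ 3 = x$3" for x
    unfolding g4 g by (simp_all add: field_simps phi)
  show "g ^^ 5 = id"
    by (simp add: fun_eq_iff numeral_eq_Suc vec_eq_iff forall_3 g5)
  have "g (g (vector [0, 1, 0])) $ 1 \<noteq> 0" unfolding gg by simp
  then show "g \<circ> g \<noteq> id" by (metis comp_apply id_apply vector_3(1))
qed

section \<open>Scaled and rotated copies\<close>

text \<open>The properties of a cube or dodecahedron centred at the origin from which the theorem follows. The
  number \<open>m\<close> is the order of the smallest turn about a face centre; as it is 4 or 5 below, the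
  condition \<open>g \<circ> g \<noteq> id\<close> suffices for \<open>g\<close> to have order \<open>m\<close>.\<close>

definition platonic :: "nat \<Rightarrow> (real^3) set \<Rightarrow> bool" where
  "platonic m P \<longleftrightarrow> aff_dim P = 3 \<and>
     (\<forall>D D'. D face_of P \<longrightarrow> D' face_of P \<longrightarrow> aff_dim D = aff_dim D' \<longrightarrow> aff_dim D \<in> {0, 1, 2} \<longrightarrow>
        (\<exists>g\<in>rotations P. g ` D = D')) \<and>
     (\<forall>x. x \<noteq> 0 \<longrightarrow> (\<exists>g\<in>rotations P. \<exists>h\<in>rotations P. card {x, g x, h x} = 3)) \<and>
     (\<exists>g\<in>rotations P. g ^^ m = id \<and> g \<circ> g \<noteq> id)"

lemma (in reflection_polytope) platonicI:
  assumes "tetrahedral P" "(mirror a\<^sub>e \<circ> mirror a\<^sub>v) ^^ m = id"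
    "(mirror a\<^sub>e \<circ> mirror a\<^sub>v) \<circ> (mirror a\<^sub>e \<circ> mirror a\<^sub>v) \<noteq> id"
  shows "platonic m P"
proof -
  have "a\<^sub>v \<noteq> 0" "a\<^sub>e \<noteq> 0" using wall_v wall_e by auto
  then have "mirror a\<^sub>e \<circ> mirror a\<^sub>v \<in> rotations P"
    using symmetries_comp mirror_symmetry
    by (simp add: rotations_def matrix_compose det_mul linear_mirror det_mirror)
  moreover have "\<exists>g\<in>rotations P. g ` D = D'"
    if "D face_of P" "D' face_of P" "aff_dim D = aff_dim D'" "aff_dim D \<in> {0, 1, 2}" for D D'
    using rotation_transitive_on_faces[OF that(1,2,3) refl] that(3,4) by (auto simp: rotations_def)
  ultimately show ?thesis
    unfolding platonic_def using aff_dim_P tetrahedral_orbit assms by blast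
qed

text \<open>Rotations are transported by conjugation with \<open>k\<close>, faces by the linear bijection itself.\<close>

lemma platonic_scaled_image:
  assumes P: "platonic m P" and k: "orthogonal_transformation k" and r: "r > 0"
  shows "platonic m ((\<lambda>x. r *\<^sub>R k x) ` P)"
proof -
  define L where "L = (\<lambda>x. r *\<^sub>R k x)"
  have lin: "linear k" "linear (inv k)" and inj: "inj k" and surj: "surj k"
    using k orthogonal_transformation_inv[OF k] orthogonal_transformation_inj[OF k]
      orthogonal_transformation_surj[OF k]
    by (auto simp: orthogonal_transformation_def)
  have inv[simp]: "inv k (k x) = x" "k (inv k x) = x" for x
    using inj surj by (simp_all add: surj_f_inv_f)
  have L: "linear L" "inj L"
    using lin inj r by (auto simp: L_def inj_def linear_compose_scale_right)
  define conj where "conj = (\<lambda>g :: real^3 \<Rightarrow> real^3. k \<circ> (g \<circ> inv k))"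
  have conj_L: "conj g (L x) = L (g x)" if "linear g" for g x
    using that lin by (simp add: conj_def L_def linear_scale)
  have conj_rot: "conj g \<in> rotations (L ` P)" if g: "g \<in> rotations P" for g
  proof -
    have o: "orthogonal_transformation g" "g ` P = P" "det (matrix g) = 1" and ling: "linear g"
      using g symmetry_linear[of g P] by (simp_all add: rotations_def) (simp_all add: symmetries_def)
    have "orthogonal_transformation (conj g)"
      unfolding conj_def using k o(1) by (intro orthogonal_transformation_compose orthogonal_transformation_inv)
    moreover have "conj g ` L ` P = L ` P"
      using o(2) conj_L[OF ling] by (metis (no_types, lifting) image_cong image_image)
    moreover have "det (matrix (conj g)) = 1"
    proof -
      have "k \<circ> inv k = id" by (simp add: fun_eq_iff)
      then have "det (matrix k) * det (matrix (inv k)) = 1"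
        using lin by (metis det_I det_mul matrix_compose matrix_id_mat_1)
      then show ?thesis
        using o(3) lin ling unfolding conj_def by (simp add: matrix_compose linear_compose det_mul)
    qed
    ultimately show ?thesis by (simp add: rotations_def symmetries_def)
  qed
  have pre: "\<exists>D0. D = L ` D0 \<and> D0 face_of P \<and> aff_dim D0 = aff_dim D" if "D face_of L ` P" for D
  proof -
    have "D \<subseteq> L ` P" using that face_of_imp_subset by blast
    then obtain D0 where "D = L ` D0" "D0 \<subseteq> P" by (auto simp: subset_image_iff)
    with that L show ?thesis by (metis aff_dim_injective_linear_image face_of_linear_image)
  qed
  have rot_lin: "linear g" if "g \<in> rotations P" for g
    using that symmetry_linear[of g P] by (simp add: rotations_def)
  have "\<exists>g\<in>rotations (L ` P). g ` D = D'"
    if D: "D face_of L ` P" "D' face_of L ` P" "aff_dim D = aff_dim D'" "aff_dim D \<in> {0, 1, 2}" for D D'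
  proof -
    obtain D0 D0' where D0: "D = L ` D0" "D0 face_of P" "aff_dim D0 = aff_dim D"
      and D0': "D' = L ` D0'" "D0' face_of P" "aff_dim D0' = aff_dim D'"
      using pre[OF D(1)] pre[OF D(2)] by blast
    moreover have "aff_dim D0 = aff_dim D0'" "aff_dim D0 \<in> {0, 1, 2}" using D(3,4) D0 D0' by auto
    ultimately obtain g where g: "g \<in> rotations P" "g ` D0 = D0'"
      using P unfolding platonic_def by blast
    then have "conj g ` L ` D0 = L ` D0'"
      using conj_L[OF rot_lin[OF g(1)]] by (metis (no_types, lifting) image_cong image_image)
    then have "conj g ` D = D'" by (simp only: D0(1) D0'(1))
    with conj_rot g show ?thesis by blast
  qed
  moreover have "\<exists>g\<in>rotations (L ` P). \<exists>h\<in>rotations (L ` P). card {x, g x, h x} = 3" if "x \<noteq> 0" for x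
  proof -
    have "inv k x \<noteq> 0" using that inv(2)[of x] lin by (metis linear_0)
    then obtain g h where gh: "g \<in> rotations P" "h \<in> rotations P" "card {inv k x, g (inv k x), h (inv k x)} = 3"
      using P unfolding platonic_def by blast
    have "{x, conj g x, conj h x} = k ` {inv k x, g (inv k x), h (inv k x)}" by (simp add: conj_def)
    moreover have "card (k ` {inv k x, g (inv k x), h (inv k x)}) = 3"
      using gh(3) inj by (metis card_image inj_on_subset subset_UNIV)
    ultimately show ?thesis using gh conj_rot by metis
  qed
  moreover have "\<exists>g\<in>rotations (L ` P). g ^^ m = id \<and> g \<circ> g \<noteq> id"
  proof -
    obtain g where g: "g \<in> rotations P" "g ^^ m = id" "g \<circ> g \<noteq> id"
      using P unfolding platonic_def by blast
    have bij: "bij k" using inj surj by (simp add: bij_def)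
    have c: "conj g = k \<circ> g \<circ> inv k" by (simp add: conj_def comp_assoc)
    have "conj g ^^ m = id"
      unfolding c conjugate_funpow[OF bij] g(2) by (simp add: fun_eq_iff)
    moreover have "conj g \<circ> conj g = k \<circ> (g \<circ> g) \<circ> inv k" by (simp add: c fun_eq_iff)
    then have "conj g \<circ> conj g \<noteq> id" using conjugate_eq_id[OF bij] g(3) by metis
    ultimately show ?thesis using conj_rot g by blast
  qed
  moreover have "aff_dim (L ` P) = 3" using P L by (simp add: platonic_def aff_dim_injective_linear_image)
  ultimately show ?thesis unfolding L_def platonic_def by blast
qed

lemma vertices_similar_image:
  assumes f: "orthogonal_transformation f" and r: "r > 0"
  shows "vertices ((\<lambda>x. t + r *\<^sub>R f x) ` P) = (\<lambda>x. t + r *\<^sub>R f x) ` vertices P"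
proof -
  define L where "L = (\<lambda>x. r *\<^sub>R f x)"
  have L: "linear L" "inj L"
    using f r orthogonal_transformation_inj[OF f]
    by (auto simp: L_def inj_def linear_compose_scale_right orthogonal_transformation_def)
  have img: "(\<lambda>x. t + r *\<^sub>R f x) ` A = (+) t ` L ` A" for A by (simp add: L_def image_image)
  have "u extreme_point_of P \<longleftrightarrow> (t + L u) extreme_point_of ((+) t ` L ` P)" for u
    using face_of_translation_eq[of t "L ` {u}" "L ` P"] face_of_linear_image[OF L, of "{u}" P]
    by (simp add: face_of_singleton)
  moreover have "\<exists>u. w = t + L u" if "w extreme_point_of ((+) t ` L ` P)" for w
    using that by (auto simp: extreme_point_of_def)
  ultimately show ?thesis unfolding img vertices_def by blast
qed

lemma centre_similar_image:
  assumes f: "orthogonal_transformation f" and r: "r > 0"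
    and fin: "finite (vertices P)" "vertices P \<noteq> {}"
  shows "centre ((\<lambda>x. t + r *\<^sub>R f x) ` P) = t + r *\<^sub>R f (centre P)"
proof -
  let ?s = "\<lambda>x. t + r *\<^sub>R f x"
  have inj: "inj_on ?s (vertices P)"
    using r orthogonal_transformation_inj[OF f] by (auto simp: inj_on_def inj_def)
  have lin: "linear f" using f by (simp add: orthogonal_transformation_def)
  let ?n = "real (card (vertices P))"
  have n: "?n \<noteq> 0" using fin by simp
  have "(\<Sum>v\<in>?s ` vertices P. v) = ?n *\<^sub>R t + r *\<^sub>R f (\<Sum>v\<in>vertices P. v)"
    by (simp add: sum.reindex[OF inj] sum.distrib linear_sum[OF lin] scaleR_sum_right sum_constant_scaleR del: sum_constant)
  then show ?thesis
    unfolding centre_def vertices_similar_image[OF f r] card_image[OF inj]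
    using n lin by (simp add: scaleR_add_right linear_scale)
qed

lemma centre_antipodal:
  assumes "\<And>x. x \<in> P \<Longrightarrow> - x \<in> P"
  shows "centre P = 0"
proof -
  have u: "uminus ` P = P" using assms by force
  have "orthogonal_transformation (\<lambda>x :: real^3. - x)"
    by (simp add: orthogonal_transformation_neg orthogonal_transformation_id)
  from vertices_similar_image[OF this, of 1 0 P]
  have "vertices P = uminus ` vertices P" by (simp add: u)
  then have "(\<Sum>v\<in>vertices P. v) = (\<Sum>v\<in>uminus ` vertices P. v)" by simp
  also have "\<dots> = - (\<Sum>v\<in>vertices P. v)" by (simp add: sum.reindex sum_negf)
  finally have "2 *\<^sub>R (\<Sum>v\<in>vertices P. v) = 0" by (simp add: scaleR_2 eq_neg_iff_add_eq_0)
  then have "(\<Sum>v\<in>vertices P. v) = 0" by simp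
  then show ?thesis by (simp add: centre_def)
qed

text \<open>Since the polytope \<open>P\<close> is symmetric about 0, its centre is 0, and so the similarity has no
  translation part.\<close>

lemma (in reflection_polytope) similar_copy_platonic:
  assumes s: "similarity s" "Q = s ` P" "centre Q = 0" and P: "platonic m P"
  shows "platonic m Q"
proof -
  obtain f r t where f: "orthogonal_transformation f" "r > 0" "s = (\<lambda>x. t + r *\<^sub>R f x)"
    using s by (auto simp: similarity_def)
  have "finite (vertices P)"
    using polytope by (simp add: vertices_def finite_polyhedron_extreme_points polytope_imp_polyhedron)
  moreover have "vertices P \<noteq> {}"
    using extreme_point_exists_convex[of P] polytope zero_in
    by (auto simp: vertices_def polytope_imp_compact polytope_imp_convex)
  moreover have "f 0 = 0" using f by (simp add: orthogonal_transformation_def linear_0)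
  ultimately have "t = 0"
    using centre_similar_image[OF f(1,2), of P t] centre_antipodal[of P] antipodal s(2,3) f(3) by simp
  then show ?thesis using platonic_scaled_image[OF P f(1,2)] s(2) f(3) by simp
qed

lemma standard_dodecahedron_platonic: "platonic 5 standard_dodecahedron"
  using reflection_polytope.platonicI[OF reflection_polytope_dodecahedron tetrahedral_dodecahedron]
    dodecahedron_rotation_order by blast

lemma standard_cube_platonic: "platonic 4 (cbox (-1) 1)"
  using reflection_polytope.platonicI[OF reflection_polytope_cube tetrahedral_cube]
    cube_rotation_order by blast

lemma centred_dodecahedron_or_cube_platonic:
  assumes "regular_dodecahedron P \<or> cube P" "centre P = 0"
  obtains m where "m = 4 \<or> m = 5" "platonic m P"
  using assms(1)
proof
  assume "regular_dodecahedron P"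
  then obtain s where "similarity s" "P = s ` standard_dodecahedron" by (auto simp: regular_dodecahedron_def)
  then have "platonic 5 P"
    using reflection_polytope.similar_copy_platonic[OF reflection_polytope_dodecahedron]
      standard_dodecahedron_platonic assms(2) by blast
  then show thesis using that by blast
next
  assume "cube P"
  then obtain s where s: "similarity s" "P = s ` cbox 0 1" unfolding cube_def by blast
  then obtain f r t where f: "orthogonal_transformation f" "r > 0" and "s = (\<lambda>x. t + r *\<^sub>R f x)"
    unfolding similarity_def by blast
  with s(2) have P: "P = (\<lambda>x. t + r *\<^sub>R f x) ` cbox 0 1" by simp
  let ?h = "\<lambda>x :: real^3. (1/2) *\<^sub>R 1 + (1/2) *\<^sub>R x"
  \<comment> \<open>The unit cube is not centred at the origin; composing with \<open>?h\<close> makes the similarity start from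
      the centred cube.\<close>
  have "cbox 0 1 = ?h ` cbox (-1) 1"
  proof
    show "cbox 0 1 \<subseteq> ?h ` cbox (-1) 1"
    proof
      fix x :: "real^3" assume "x \<in> cbox 0 1"
      then have "2 *\<^sub>R x - 1 \<in> cbox (-1) 1" by (simp add: mem_box_cart)
      moreover have "x = ?h (2 *\<^sub>R x - 1)" by (simp add: vec_eq_iff field_simps)
      ultimately show "x \<in> ?h ` cbox (-1) 1" by blast
    qed
    show "?h ` cbox (-1) 1 \<subseteq> cbox 0 1" by (auto simp: mem_box_cart forall_3)
  qed
  moreover have "t + r *\<^sub>R f (?h x) = (t + r *\<^sub>R f ((1/2) *\<^sub>R 1)) + (r / 2) *\<^sub>R f x" for x
    using f(1) by (simp add: orthogonal_transformation_def linear_add linear_scale scaleR_add_right)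
  ultimately have P': "P = (\<lambda>x. (t + r *\<^sub>R f ((1/2) *\<^sub>R 1)) + (r / 2) *\<^sub>R f x) ` cbox (-1) 1"
    unfolding P by (simp only: image_image)
  have "similarity (\<lambda>x. (t + r *\<^sub>R f ((1/2) *\<^sub>R 1)) + (r / 2) *\<^sub>R f x)"
    unfolding similarity_def
    by (intro exI[of _ f] exI[of _ "r / 2"] exI[of _ "t + r *\<^sub>R f ((1/2) *\<^sub>R 1)"]) (use f in simp)
  then have "platonic 4 P"
    using reflection_polytope.similar_copy_platonic[OF reflection_polytope_cube _ P' assms(2)]
      standard_cube_platonic by blast
  then show thesis using that by blast
qed

section \<open>Rotation groups and stabilizers as groups of Moebius maps\<close>

unbundle m_inv_syntax

lemma rotation_group_eq: "rotation_group P = (\<lambda>g. restrict g riemann_sphere) ` rotations P"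
  by (auto simp: rotation_group_def rotations_def symmetries_def)

lemma rotations_inv:
  assumes "g \<in> rotations P"
  shows "inv_into UNIV g \<in> rotations P"
proof -
  have g: "g \<in> symmetries P" "det (matrix g) = 1" using assms by (auto simp: rotations_def)
  have i: "inv_into UNIV g \<in> symmetries P" using g(1) by (rule symmetries_inv)
  have "orthogonal_transformation g" using g(1) by (simp add: symmetries_def)
  then have "g \<circ> inv_into UNIV g = id"
    by (simp add: fun_eq_iff orthogonal_transformation_surj surj_f_inv_f)
  then have "det (matrix g) * det (matrix (inv_into UNIV g)) = 1"
    using symmetry_linear[OF g(1)] symmetry_linear[OF i] by (metis det_I det_mul matrix_compose matrix_id_mat_1)
  then show ?thesis using i g(2) by (simp add: rotations_def)
qed

lemma rotations_sphere: "g \<in> rotations P \<Longrightarrow> x \<in> riemann_sphere \<Longrightarrow> g x \<in> riemann_sphere"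
  using orthogonal_sphere by (auto simp: rotations_def symmetries_def simp del: mem_sphere_0)

lemma rotation_group_moebius: "rotation_group P \<subseteq> moebius_group"
  unfolding rotation_group_eq rotations_def symmetries_def
  using rotation_sphere_moebius restrict_in_moebius_group by blast

lemma moebius_group_Bij: "f \<in> moebius_group \<Longrightarrow> f \<in> Bij riemann_sphere"
  using subgroup.subset[OF moebius_group_subgroup] by (auto simp: BijGroup_def)

lemma BijGroup_mult: "f \<in> Bij S \<Longrightarrow> g \<in> Bij S \<Longrightarrow> f \<otimes>\<^bsub>BijGroup S\<^esub> g = compose S f g"
  by (simp add: BijGroup_def)

lemma moebius_group_mult:
  assumes "f \<in> moebius_group" "g \<in> moebius_group"
  shows "f \<otimes>\<^bsub>BijGroup riemann_sphere\<^esub> g = compose riemann_sphere f g"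
  using assms moebius_group_Bij by (intro BijGroup_mult)

lemma moebius_group_inv_apply:
  assumes "f \<in> moebius_group" "x \<in> riemann_sphere"
  shows "(inv\<^bsub>BijGroup riemann_sphere\<^esub> f) (f x) = x"
proof -
  have f: "f \<in> Bij riemann_sphere" using assms(1) by (rule moebius_group_Bij)
  then have "f x \<in> riemann_sphere" "inj_on f riemann_sphere"
    using assms(2) by (auto simp: Bij_def bij_betw_def)
  then show ?thesis using assms(2) by (simp add: inv_BijGroup[OF f] del: mem_sphere_0)
qed

lemma moebius_stabilizer_subgroup:
  assumes "\<alpha> \<subseteq> riemann_sphere"
  shows "subgroup (moebius_stabilizer \<alpha>) (BijGroup riemann_sphere)"
proof (rule group.subgroupI[OF group_BijGroup])
  let ?K = "BijGroup riemann_sphere"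
  interpret M: subgroup moebius_group ?K by (rule moebius_group_subgroup)
  show "moebius_stabilizer \<alpha> \<subseteq> carrier ?K" using M.subset by (auto simp: moebius_stabilizer_def)
  have "(\<lambda>x\<in>riemann_sphere. x) \<in> moebius_group" using M.one_closed by (simp add: BijGroup_def)
  moreover have "(\<lambda>x\<in>riemann_sphere. x) ` \<alpha> = \<alpha>" using assms by force
  ultimately show "moebius_stabilizer \<alpha> \<noteq> {}" unfolding moebius_stabilizer_def by blast
  fix f assume f: "f \<in> moebius_stabilizer \<alpha>"
  then have fM: "f \<in> moebius_group" and f\<alpha>: "f ` \<alpha> = \<alpha>" by (auto simp: moebius_stabilizer_def)
  have "(inv\<^bsub>?K\<^esub> f) ` \<alpha> = \<alpha>"
  proof -
    have "(inv\<^bsub>?K\<^esub> f) ` f ` \<alpha> = \<alpha>"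
    proof -
      have "(inv\<^bsub>?K\<^esub> f) (f x) = x" if "x \<in> \<alpha>" for x
        using that assms moebius_group_inv_apply[OF fM] by blast
      then show ?thesis unfolding image_image by simp
    qed
    then show ?thesis by (simp only: f\<alpha>)
  qed
  then show "inv\<^bsub>?K\<^esub> f \<in> moebius_stabilizer \<alpha>"
    using M.m_inv_closed[OF fM] by (simp add: moebius_stabilizer_def)
  fix g assume "g \<in> moebius_stabilizer \<alpha>"
  then have gM: "g \<in> moebius_group" and g\<alpha>: "g ` \<alpha> = \<alpha>" by (auto simp: moebius_stabilizer_def)
  have "compose riemann_sphere f g ` \<alpha> = f ` g ` \<alpha>"
    using assms unfolding image_image by (intro image_cong) (auto simp: compose_def)
  then show "f \<otimes>\<^bsub>?K\<^esub> g \<in> moebius_stabilizer \<alpha>"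
    using M.m_closed[OF fM gM] moebius_group_mult[OF fM gM] f\<alpha> g\<alpha> by (simp add: moebius_stabilizer_def)
qed

lemma rotation_group_subgroup: "subgroup (rotation_group P) (BijGroup riemann_sphere)"
proof (rule group.subgroupI[OF group_BijGroup])
  let ?K = "BijGroup riemann_sphere"
  show "rotation_group P \<subseteq> carrier ?K"
    using rotation_group_moebius subgroup.subset[OF moebius_group_subgroup] by blast
  have "id \<in> rotations P"
    by (simp add: rotations_def symmetries_def matrix_id_mat_1) (simp add: id_def orthogonal_transformation_id)
  then show "rotation_group P \<noteq> {}" unfolding rotation_group_eq by blast
  fix f assume f: "f \<in> rotation_group P"
  then obtain g where g: "g \<in> rotations P" "f = restrict g riemann_sphere" unfolding rotation_group_eq by blast
  have fM: "f \<in> moebius_group" using f rotation_group_moebius by blast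
  have "inj g" using g(1) symmetry_inj[of g P] by (simp add: rotations_def)
  have gi: "inv_into UNIV g \<in> rotations P" using g(1) by (rule rotations_inv)
  have "restrict (inv_into UNIV g) riemann_sphere = inv\<^bsub>?K\<^esub> f"
  proof (rule group.inv_equality[OF group_BijGroup, symmetric])
    let ?h = "restrict (inv_into UNIV g) riemann_sphere"
    have hM: "?h \<in> moebius_group" using gi rotation_group_moebius unfolding rotation_group_eq by blast
    show "?h \<in> carrier ?K" "f \<in> carrier ?K"
      using hM fM subgroup.subset[OF moebius_group_subgroup] by auto
    have "compose riemann_sphere ?h f = (\<lambda>x\<in>riemann_sphere. x)"
      using rotations_sphere[OF g(1)] \<open>inj g\<close>
      by (auto simp: compose_def g(2) fun_eq_iff restrict_def simp del: mem_sphere_0)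
    then show "?h \<otimes>\<^bsub>?K\<^esub> f = \<one>\<^bsub>?K\<^esub>"
      unfolding moebius_group_mult[OF hM fM] by (simp add: BijGroup_def)
  qed
  then show "inv\<^bsub>?K\<^esub> f \<in> rotation_group P"
    using gi unfolding rotation_group_eq by (metis imageI)
  fix f' assume f': "f' \<in> rotation_group P"
  then obtain g' where g': "g' \<in> rotations P" "f' = restrict g' riemann_sphere" unfolding rotation_group_eq by blast
  have f'M: "f' \<in> moebius_group" using f' rotation_group_moebius by blast
  have "compose riemann_sphere f f' = restrict (g \<circ> g') riemann_sphere"
    using rotations_sphere[OF g'(1)]
    by (auto simp: compose_def g(2) g'(2) fun_eq_iff restrict_def simp del: mem_sphere_0)
  then show "f \<otimes>\<^bsub>?K\<^esub> f' \<in> rotation_group P"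
    unfolding moebius_group_mult[OF fM f'M] rotation_group_eq using rotations_comp[OF g(1) g'(1)] by blast
qed

text \<open>Three points determine a Moebius transformation, so an element of the stabilizer is determined by
  the way it permutes \<open>\<alpha>\<close>.\<close>

lemma finite_moebius_stabilizer:
  assumes \<alpha>: "\<alpha> \<subseteq> riemann_sphere" "finite \<alpha>" "3 \<le> card \<alpha>"
  shows "finite (moebius_stabilizer \<alpha>)"
proof (rule inj_on_finite)
  let ?K = "BijGroup riemann_sphere"
  interpret M: subgroup moebius_group ?K by (rule moebius_group_subgroup)
  show "finite (\<alpha> \<rightarrow>\<^sub>E \<alpha>)" using \<alpha> by (intro finite_PiE) auto
  show "(\<lambda>f. restrict f \<alpha>) ` moebius_stabilizer \<alpha> \<subseteq> \<alpha> \<rightarrow>\<^sub>E \<alpha>"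
    by (auto simp: moebius_stabilizer_def)
  show "inj_on (\<lambda>f. restrict f \<alpha>) (moebius_stabilizer \<alpha>)"
  proof (rule inj_onI)
    fix f g assume "f \<in> moebius_stabilizer \<alpha>" "g \<in> moebius_stabilizer \<alpha>" and eq: "restrict f \<alpha> = restrict g \<alpha>"
    then have f: "f \<in> moebius_group" and g: "g \<in> moebius_group" by (auto simp: moebius_stabilizer_def)
    define h where "h = inv\<^bsub>?K\<^esub> g \<otimes>\<^bsub>?K\<^esub> f"
    have h: "h \<in> moebius_group" unfolding h_def using f g by (intro M.m_closed M.m_inv_closed)
    have h_apply: "h x = (inv\<^bsub>?K\<^esub> g) (f x)" if "x \<in> riemann_sphere" for x
      using that moebius_group_mult[OF M.m_inv_closed[OF g] f] by (simp add: h_def compose_def)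
    have "h x = x" if "x \<in> \<alpha>" for x
    proof -
      have "f x = g x" using eq that by (metis restrict_apply')
      then show ?thesis using h_apply moebius_group_inv_apply[OF g] that \<alpha> by auto
    qed
    then have hid: "h x = x" if "x \<in> riemann_sphere" for x
      using moebius_group_three_fixed_points[OF h \<alpha>(1,3) _ that] by blast
    show "f = g"
    proof (rule extensionalityI)
      show "f \<in> extensional riemann_sphere" "g \<in> extensional riemann_sphere"
        using f g by (auto simp: moebius_group_iff)
      fix x assume x: "x \<in> riemann_sphere"
      have bij: "bij_betw g riemann_sphere riemann_sphere" "f x \<in> riemann_sphere"
        using moebius_group_Bij[OF g] moebius_group_Bij[OF f] x by (auto simp: Bij_def bij_betw_def)
      then obtain y where y: "y \<in> riemann_sphere" "f x = g y" by (metis bij_betw_def imageE)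
      then have "h x = y" using h_apply[OF x] moebius_group_inv_apply[OF g y(1)] by simp
      with hid[OF x] y show "f x = g x" by simp
    qed
  qed
qed

lemma BijGroup_pow_apply:
  assumes "f \<in> Bij S" "x \<in> S"
  shows "(f [^]\<^bsub>BijGroup S\<^esub> (n::nat)) x = (f ^^ n) x"
  using assms(2)
proof (induction n arbitrary: x)
  case 0
  then show ?case by (simp add: BijGroup_def)
next
  case (Suc n)
  interpret group "BijGroup S" by (rule group_BijGroup)
  have "f [^]\<^bsub>BijGroup S\<^esub> n \<in> Bij S" using assms(1) nat_pow_closed[of f n] by (simp add: BijGroup_def)
  then have "f [^]\<^bsub>BijGroup S\<^esub> Suc n = compose S (f [^]\<^bsub>BijGroup S\<^esub> n) f"
    unfolding nat_pow_Suc using assms(1) by (rule BijGroup_mult)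
  then have "(f [^]\<^bsub>BijGroup S\<^esub> Suc n) x = (f [^]\<^bsub>BijGroup S\<^esub> n) (f x)"
    using Suc.prems by (simp only: compose_eq)
  also have "f x \<in> S" using Suc.prems Bij_imp_funcset[OF assms(1)] by blast
  then have "(f [^]\<^bsub>BijGroup S\<^esub> n) (f x) = (f ^^ n) (f x)" by (rule Suc.IH)
  finally show ?case by (simp only: funpow_Suc_right o_apply)
qed

text \<open>A group \<open>H\<close> that contains the rotations of \<open>P\<close> inherits from them the absence of small orbits and an
  element of order \<open>m\<close>, and these determine its order. Applied to the rotation group itself and to a
  finite group containing it, this gives the maximality of the rotation group.\<close>

theorem moebius_overgroup_order:
  assumes H: "subgroup H (BijGroup riemann_sphere)" "H \<subseteq> moebius_group" "finite H"
    and G: "rotation_group P \<subseteq> H" and P: "platonic m P" and m: "m = 4 \<or> m = 5"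
  shows "m = 4 \<and> card H = 24 \<or> m = 5 \<and> card H = 60"
proof -
  let ?S = riemann_sphere
  let ?K = "BijGroup ?S"
  let ?H = "?K\<lparr>carrier := H\<rparr>"
  interpret K: group ?K by (rule group_BijGroup)
  interpret GH: group ?H using H(1) by (rule K.subgroup_imp_group)
  have one: "\<one>\<^bsub>?H\<^esub> = restrict id ?S" by (simp add: BijGroup_def id_def)
  have pow: "(f [^]\<^bsub>?H\<^esub> (n::nat)) x = (f ^^ n) x" if "f \<in> H" "x \<in> ?S" for f n x
  proof -
    have "f [^]\<^bsub>?H\<^esub> n = f [^]\<^bsub>?K\<^esub> n" by (simp add: nat_pow_def)
    then show ?thesis using BijGroup_pow_apply[of f ?S x n] that moebius_group_Bij H(2) by auto
  qed
  have "group_action ?K ?S (\<lambda>f. f)"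
    unfolding group_action_def group_hom_def group_hom_axioms_def hom_def
    using K.is_group by auto
  then interpret act: group_action ?H ?S "\<lambda>f. f"
    using H(1) by (rule group_action.induced_action)
  interpret rotation_like_action ?H ?S "\<lambda>f. f"
  proof
    show "finite (carrier ?H)" using H(3) by simp
    show "?S \<noteq> {}" using stereo_surj by blast
    show "card (invariants ?S (\<lambda>f. f) g) = 2" if g: "g \<in> carrier ?H" "g \<noteq> \<one>\<^bsub>?H\<^esub>" for g
    proof -
      have "0 < GH.ord g" using GH.ord_ge_1[OF _ g(1)] H(3) by simp
      moreover have "(g ^^ GH.ord g) x = x" if "x \<in> ?S" for x
      proof -
        have "g \<in> H" using g(1) by simp
        then have "(g ^^ GH.ord g) x = (g [^]\<^bsub>?H\<^esub> GH.ord g) x" using that by (rule pow[symmetric])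
        also have "\<dots> = \<one>\<^bsub>?H\<^esub> x" by (simp only: GH.pow_ord_eq_1[OF g(1)])
        also have "\<dots> = x" using that by (simp only: one restrict_apply' id_apply)
        finally show ?thesis .
      qed
      moreover have "g \<in> moebius_group" "g \<noteq> restrict id ?S" using g H(2) one by auto
      ultimately show ?thesis
        using moebius_group_finite_order_fixed_points unfolding invariants_def by blast
    qed
    show "3 \<le> card (Group_Action.orbit ?H (\<lambda>f. f) x)" if x: "x \<in> ?S" for x
    proof -
      have "x \<noteq> 0" using x by auto
      then obtain g h where gh: "g \<in> rotations P" "h \<in> rotations P" "card {x, g x, h x} = 3"
        using P unfolding platonic_def by blast
      have "k x \<in> Group_Action.orbit ?H (\<lambda>f. f) x" if "k \<in> rotations P" for k
      proof -
        have "restrict k ?S \<in> H" using that G unfolding rotation_group_eq by blast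
        then show ?thesis using x unfolding Group_Action.orbit_def by (auto intro!: exI[of _ "restrict k ?S"])
      qed
      then have "{x, g x, h x} \<subseteq> Group_Action.orbit ?H (\<lambda>f. f) x"
        using gh act.orbit_refl[OF x] by blast
      moreover have "finite (Group_Action.orbit ?H (\<lambda>f. f) x)"
        using H(3) by (simp add: Group_Action.orbit_def)
      ultimately show ?thesis using gh(3) by (metis card_mono)
    qed
  qed
  obtain g0 where g0: "g0 \<in> rotations P" "g0 ^^ m = id" "g0 \<circ> g0 \<noteq> id"
    using P unfolding platonic_def by blast
  define g where "g = restrict g0 ?S"
  have gH: "g \<in> H" using g0(1) G unfolding g_def rotation_group_eq by blast
  have gpow: "(g ^^ n) x = (g0 ^^ n) x \<and> (g ^^ n) x \<in> ?S" if "x \<in> ?S" for n x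
  proof (induction n)
    case (Suc n)
    have "(g ^^ Suc n) x = g0 ((g ^^ n) x)" 
      using conjunct2[OF Suc] by (simp only: funpow.simps o_apply) (simp only: g_def restrict_apply')
    then show ?case using Suc rotations_sphere[OF g0(1), of "(g ^^ n) x"] by (metis comp_apply funpow.simps(2))
  qed (use that in simp)
  have "g [^]\<^bsub>?H\<^esub> m = \<one>\<^bsub>?H\<^esub>"
  proof (rule extensionalityI[where A = ?S])
    have "g [^]\<^bsub>?H\<^esub> m \<in> H" using GH.nat_pow_closed[of g m] gH by simp
    then show "g [^]\<^bsub>?H\<^esub> m \<in> extensional ?S" using H(2) moebius_group_iff by blast
    show "\<one>\<^bsub>?H\<^esub> \<in> extensional ?S" unfolding one by simp
    show "(g [^]\<^bsub>?H\<^esub> m) x = \<one>\<^bsub>?H\<^esub> x" if "x \<in> ?S" for x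
    proof -
      have "(g [^]\<^bsub>?H\<^esub> m) x = (g ^^ m) x" by (rule pow[OF gH that])
      also have "\<dots> = x" using gpow[OF that, of m] g0(2) by simp
      also have "\<dots> = \<one>\<^bsub>?H\<^esub> x" using that by (simp only: one restrict_apply' id_apply)
      finally show ?thesis .
    qed
  qed
  then have dvd: "GH.ord g dvd m" using gH GH.pow_eq_id[of g m] by simp
  \<comment> \<open>The order of \<open>g\<close> divides \<open>m\<close>, which is 4 or 5, so it is \<open>m\<close> unless it divides 2.\<close>
  have sq: "\<not> GH.ord g dvd 2"
  proof
    assume "GH.ord g dvd 2"
    then have g2: "g [^]\<^bsub>?H\<^esub> (2::nat) = \<one>\<^bsub>?H\<^esub>" using gH GH.pow_eq_id[of g 2] by simp
    have fix_S: "g0 (g0 x) = x" if "x \<in> ?S" for x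
    proof -
      have "g0 (g0 x) = (g ^^ 2) x" using gpow[OF that, of 2] by (simp add: numeral_2_eq_2)
      also have "\<dots> = (g [^]\<^bsub>?H\<^esub> (2::nat)) x" by (rule pow[OF gH that, symmetric])
      also have "\<dots> = x" unfolding g2 using that by (simp only: one restrict_apply' id_apply)
      finally show ?thesis .
    qed
    have lin: "linear g0" using g0(1) symmetry_linear[of g0 P] by (simp add: rotations_def)
    have "g0 (g0 x) = x" for x
    proof (cases "x = 0")
      case True
      then show ?thesis using lin by (simp add: linear_0)
    next
      case False
      then have "g0 (g0 (sgn x)) = sgn x" by (intro fix_S) (simp add: norm_sgn)
      then have "g0 (g0 x) /\<^sub>R norm x = x /\<^sub>R norm x" by (simp add: sgn_div_norm linear_scale[OF lin])
      with False show ?thesis by simp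
    qed
    with g0(3) show False by (auto simp: fun_eq_iff)
  qed
  have "GH.ord g = m"
  proof -
    have "GH.ord g \<noteq> 1" "GH.ord g \<noteq> 2" using sq by auto
    moreover have "GH.ord g \<in> {1, 2, 4} \<or> GH.ord g \<in> {1, 5}"
    proof -
      have "GH.ord g \<le> 5" using dvd m by (auto dest: dvd_imp_le)
      then have "GH.ord g \<in> {0, 1, 2, 3, 4, 5}" by auto
      with dvd m show ?thesis by auto
    qed
    ultimately show ?thesis using dvd m by auto
  qed
  moreover have "g \<noteq> \<one>\<^bsub>?H\<^esub>"
  proof -
    have "GH.ord g \<noteq> 1" using sq by auto
    then show ?thesis using GH.ord_eq_1[of g] gH by simp
  qed
  ultimately have "m = 4 \<and> order ?H = 24 \<or> m = 5 \<and> order ?H = 60"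
    using order_from_element[of g m] gH m by simp
  then show ?thesis by (simp add: order_def)
qed

section \<open>Vertices, face points and edge points as orbits\<close>

lemma orthogonal_centre:
  assumes "orthogonal_transformation g"
  shows "centre (g ` Q) = g (centre Q)"
proof -
  have v: "vertices (g ` Q) = g ` vertices Q"
    using vertices_similar_image[OF assms, of 1 0 Q] by simp
  have "inj g" "linear g"
    using assms orthogonal_transformation_inj by (auto simp: orthogonal_transformation_def)
  moreover from this have "inj_on g (vertices Q)" by (meson inj_on_subset subset_UNIV)
  ultimately show ?thesis
    by (simp add: centre_def v card_image sum.reindex linear_sum linear_scale)
qed

lemma orthogonal_sgn: "orthogonal_transformation g \<Longrightarrow> g (sgn x) = sgn (g x)"
  by (simp add: sgn_div_norm orthogonal_transformation_norm orthogonal_transformation_def linear_scale)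

lemma rotation_properties:
  assumes "g \<in> rotations P"
  shows "orthogonal_transformation g" "linear g" "inj g" "g ` P = P"
    "D face_of P \<Longrightarrow> g ` D face_of P \<and> aff_dim (g ` D) = aff_dim D"
  using assms symmetry_linear[of g P] symmetry_inj[of g P] symmetry_face[of g P D]
  by (auto simp: rotations_def symmetries_def)

lemma rotation_vertices: "g \<in> rotations P \<Longrightarrow> v \<in> vertices P \<Longrightarrow> g v \<in> vertices P"
  using rotation_properties(5)[of g P "{v}"] by (simp add: vertices_def face_of_singleton)

lemma rotation_face_points:
  assumes g: "g \<in> rotations P" and x: "x \<in> face_points P"
  shows "g x \<in> face_points P"
proof -
  obtain Q where Q: "x = sgn (centre Q)" "Q facet_of P" using x by (auto simp: face_points_def)
  have "g ` Q facet_of P" using Q(2) rotation_properties(5)[OF g, of Q] by (simp add: facet_of_def)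
  moreover have "g x = sgn (centre (g ` Q))"
    using Q(1) rotation_properties(1)[OF g] by (simp add: orthogonal_sgn orthogonal_centre)
  ultimately show ?thesis unfolding face_points_def by blast
qed

lemma linear_midpoint: "linear g \<Longrightarrow> g (midpoint a b) = midpoint (g a) (g b)"
  by (simp add: midpoint_def linear_add linear_scale)

lemma rotation_edge_points:
  assumes g: "g \<in> rotations P" and x: "x \<in> edge_points P"
  shows "g x \<in> edge_points P"
proof -
  obtain a b where ab: "x = sgn (midpoint a b)" "closed_segment a b edge_of P"
    using x by (auto simp: edge_points_def)
  have "closed_segment (g a) (g b) = g ` closed_segment a b"
    using rotation_properties(2)[OF g] by (rule closed_segment_linear_image)
  then have "closed_segment (g a) (g b) edge_of P"
    using ab(2) rotation_properties(5)[OF g, of "closed_segment a b"] by (simp add: edge_of_def)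
  moreover have "g x = sgn (midpoint (g a) (g b))"
    using ab(1) rotation_properties(1,2)[OF g] by (simp add: orthogonal_sgn linear_midpoint)
  ultimately show ?thesis unfolding edge_points_def by blast
qed

context
  fixes m P
  assumes P: "platonic m P"
begin

lemma face_transitive:
  assumes "D face_of P" "D' face_of P" "aff_dim D = d" "aff_dim D' = d" "d \<in> {0, 1, 2}"
  obtains g where "g \<in> rotations P" "g ` D = D'"
  using P assms unfolding platonic_def by metis

lemma vertices_transitive:
  assumes "x \<in> vertices P" "y \<in> vertices P"
  obtains g where "g \<in> rotations P" "g x = y"
proof -
  have "{x} face_of P" "{y} face_of P" using assms by (auto simp: vertices_def face_of_singleton)
  then obtain g where "g \<in> rotations P" "g ` {x} = {y}" by (rule face_transitive[where d = 0]) auto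
  then show thesis using that by auto
qed

lemma face_points_transitive:
  assumes "x \<in> face_points P" "y \<in> face_points P"
  obtains g where "g \<in> rotations P" "g x = y"
proof -
  obtain Q where Q: "x = sgn (centre Q)" "Q facet_of P" using assms by (auto simp: face_points_def)
  obtain R where R: "y = sgn (centre R)" "R facet_of P" using assms by (auto simp: face_points_def)
  have "aff_dim P = 3" using P by (simp add: platonic_def)
  then have "Q face_of P" "R face_of P" "aff_dim Q = 2" "aff_dim R = 2"
    using Q R by (auto simp: facet_of_def)
  then obtain g where g: "g \<in> rotations P" "g ` Q = R" by (rule face_transitive) auto
  have "g x = y"
    unfolding Q(1) R(1) g(2)[symmetric] using rotation_properties(1)[OF g(1)]
    by (simp add: orthogonal_sgn orthogonal_centre)
  with g show thesis by (intro that)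
qed

lemma edge_points_transitive:
  assumes "x \<in> edge_points P" "y \<in> edge_points P"
  obtains g where "g \<in> rotations P" "g x = y"
proof -
  obtain a b where ab: "x = sgn (midpoint a b)" "closed_segment a b edge_of P"
    using assms by (auto simp: edge_points_def)
  obtain c d where cd: "y = sgn (midpoint c d)" "closed_segment c d edge_of P"
    using assms by (auto simp: edge_points_def)
  have "closed_segment a b face_of P" "closed_segment c d face_of P"
    "aff_dim (closed_segment a b) = 1" "aff_dim (closed_segment c d) = 1"
    using ab cd by (auto simp: edge_of_def)
  then obtain g where g: "g \<in> rotations P" "g ` closed_segment a b = closed_segment c d"
    by (rule face_transitive) auto
  have "closed_segment (g a) (g b) = closed_segment c d"
    using g(2) closed_segment_linear_image[OF rotation_properties(2)[OF g(1)], of a b] by simp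
  then have "{g a, g b} = {c, d}" by (simp add: closed_segment_eq)
  then have "midpoint (g a) (g b) = midpoint c d"
    by (auto simp: doubleton_eq_iff midpoint_sym)
  then have "g x = y"
    unfolding ab(1) cd(1) using rotation_properties(1,2)[OF g(1)]
    by (simp add: orthogonal_sgn linear_midpoint)
  with g show thesis by (intro that)
qed

text \<open>The stabilizer contains the rotation group, and both have the order determined by \<open>m\<close>.\<close>

lemma invariant_imp_stabilizer_eq:
  assumes m: "m = 4 \<or> m = 5" and \<alpha>: "\<alpha> \<subseteq> riemann_sphere" "finite \<alpha>" "\<alpha> \<noteq> {}"
    and inv: "\<And>g x. g \<in> rotations P \<Longrightarrow> x \<in> \<alpha> \<Longrightarrow> g x \<in> \<alpha>"
  shows "moebius_stabilizer \<alpha> = rotation_group P"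
proof -
  obtain x where x: "x \<in> \<alpha>" using \<alpha>(3) by blast
  then have "x \<noteq> 0" using \<alpha>(1) by auto
  then obtain g h where gh: "g \<in> rotations P" "h \<in> rotations P" "card {x, g x, h x} = 3"
    using P unfolding platonic_def by blast
  then have "{x, g x, h x} \<subseteq> \<alpha>" using inv x by blast
  then have "3 \<le> card \<alpha>" using gh(3) \<alpha>(2) by (metis card_mono)
  then have fin: "finite (moebius_stabilizer \<alpha>)" using finite_moebius_stabilizer \<alpha> by blast
  have sub: "rotation_group P \<subseteq> moebius_stabilizer \<alpha>"
  proof
    fix f assume f: "f \<in> rotation_group P"
    then obtain g where g: "g \<in> rotations P" "f = restrict g riemann_sphere"
      unfolding rotation_group_eq by blast
    have "f ` \<alpha> = g ` \<alpha>" using \<alpha>(1) g(2) by (intro image_cong) auto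
    moreover have "g ` \<alpha> = \<alpha>"
      using inv[OF g(1)] \<alpha>(2) rotation_properties(3)[OF g(1)]
      by (intro endo_inj_surj) (auto intro: inj_on_subset)
    ultimately show "f \<in> moebius_stabilizer \<alpha>"
      using f rotation_group_moebius[of P] by (auto simp: moebius_stabilizer_def)
  qed
  have "m = 4 \<and> card (moebius_stabilizer \<alpha>) = 24 \<or> m = 5 \<and> card (moebius_stabilizer \<alpha>) = 60"
    using moebius_stabilizer_subgroup[OF \<alpha>(1)] _ fin sub P m
    by (rule moebius_overgroup_order) (auto simp: moebius_stabilizer_def)
  moreover have "m = 4 \<and> card (rotation_group P) = 24 \<or> m = 5 \<and> card (rotation_group P) = 60"
    using rotation_group_subgroup rotation_group_moebius finite_subset[OF sub fin] order_refl P m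
    by (rule moebius_overgroup_order)
  ultimately have "card (rotation_group P) = card (moebius_stabilizer \<alpha>)" by auto
  then show ?thesis using card_subset_eq[OF fin sub] by simp
qed

end

section \<open>Sets with a prescribed stabilizer\<close>

theorem theorem6:
  fixes P \<alpha> V F E :: "(real^3) set"
    and G :: "(real^3 \<Rightarrow> real^3) set"
    and B :: "real^3 \<Rightarrow> (real^3) set"
  assumes "regular_dodecahedron P \<or> cube P"
    and "vertices P \<subseteq> riemann_sphere"
    and "centre P = 0"
  defines "G \<equiv> rotation_group P"
    and "V \<equiv> vertices P"
    and "F \<equiv> face_points P"
    and "E \<equiv> edge_points P"
    and "B \<equiv> orbit G"
  assumes "\<alpha> \<subseteq> riemann_sphere" and "finite \<alpha>" and "\<alpha> \<noteq> {}"
  shows "moebius_stabilizer \<alpha> = G \<longleftrightarrow>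
    (\<exists>\<C>. finite \<C> \<and> \<C> \<subseteq> {V, F, E} \<union> {B X | X. X \<in> riemann_sphere - (V \<union> F \<union> E)} \<and> \<alpha> = \<Union>\<C>)"
proof -
  define fam where "fam = {V, F, E} \<union> {B X | X. X \<in> riemann_sphere - (V \<union> F \<union> E)}"
  obtain m where m: "m = 4 \<or> m = 5" and P: "platonic m P"
    using centred_dodecahedron_or_cube_platonic assms(1,3) by blast
  have B: "B X = (\<lambda>g. g X) ` rotations P" if "X \<in> riemann_sphere" for X
  proof -
    have "B X = (\<lambda>g. g X) ` G" unfolding B_def orbit_def by blast
    then show ?thesis using that by (simp add: G_def rotation_group_eq image_image)
  qed
  show ?thesis
    unfolding fam_def[symmetric]
  proof
    assume eq: "moebius_stabilizer \<alpha> = G"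
    have inv: "g x \<in> \<alpha>" if "g \<in> rotations P" "x \<in> \<alpha>" for g x
    proof -
      have "restrict g riemann_sphere \<in> moebius_stabilizer \<alpha>"
        using that(1) unfolding eq G_def rotation_group_eq by blast
      then have "restrict g riemann_sphere ` \<alpha> = \<alpha>" by (simp add: moebius_stabilizer_def)
      moreover have "restrict g riemann_sphere x = g x" using that(2) assms(9) by auto
      ultimately show ?thesis using that(2) by (metis imageI)
    qed
    have "\<exists>C\<in>fam. x \<in> C \<and> C \<subseteq> \<alpha>" if x: "x \<in> \<alpha>" for x
    proof -
      consider "x \<in> V" | "x \<in> F" | "x \<in> E" | "x \<in> riemann_sphere - (V \<union> F \<union> E)"
        using x assms(9) by blast
      then show ?thesis
      proof cases
        case 1
        have "V \<subseteq> \<alpha>"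
        proof
          fix y assume "y \<in> V"
          then obtain g where "g \<in> rotations P" "g x = y"
            using vertices_transitive[OF P] 1 unfolding V_def by metis
          then show "y \<in> \<alpha>" using inv x by blast
        qed
        moreover have "V \<in> fam" by (simp add: fam_def)
        ultimately show ?thesis using 1 by blast
      next
        case 2
        have "F \<subseteq> \<alpha>"
        proof
          fix y assume "y \<in> F"
          then obtain g where "g \<in> rotations P" "g x = y"
            using face_points_transitive[OF P] 2 unfolding F_def by metis
          then show "y \<in> \<alpha>" using inv x by blast
        qed
        moreover have "F \<in> fam" by (simp add: fam_def)
        ultimately show ?thesis using 2 by blast
      next
        case 3
        have "E \<subseteq> \<alpha>"
        proof
          fix y assume "y \<in> E"
          then obtain g where "g \<in> rotations P" "g x = y"
            using edge_points_transitive[OF P] 3 unfolding E_def by metis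
          then show "y \<in> \<alpha>" using inv x by blast
        qed
        moreover have "E \<in> fam" by (simp add: fam_def)
        ultimately show ?thesis using 3 by blast
      next
        case 4
        then have Bx: "B x = (\<lambda>g. g x) ` rotations P" by (intro B) blast
        have "id \<in> rotations P"
          by (simp add: rotations_def symmetries_def matrix_id_mat_1)
            (simp add: id_def orthogonal_transformation_id)
        then have "x \<in> B x" unfolding Bx by (rule image_eqI[rotated]) simp
        moreover have "B x \<subseteq> \<alpha>" unfolding Bx using inv[OF _ x] by (rule image_subsetI)
        ultimately have "x \<in> B x \<and> B x \<subseteq> \<alpha>" ..
        moreover have "B x \<in> fam" using 4 unfolding fam_def by blast
        ultimately show ?thesis by blast
      qed
    qed
    then have "\<alpha> = \<Union>{C \<in> fam. C \<subseteq> \<alpha>}" by blast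
    moreover have "finite {C \<in> fam. C \<subseteq> \<alpha>}"
      using assms(10) by (auto intro: finite_subset[of _ "Pow \<alpha>"])
    ultimately show "\<exists>\<C>. finite \<C> \<and> \<C> \<subseteq> fam \<and> \<alpha> = \<Union>\<C>" by blast
  next
    assume "\<exists>\<C>. finite \<C> \<and> \<C> \<subseteq> fam \<and> \<alpha> = \<Union>\<C>"
    then obtain \<C> where \<C>: "\<C> \<subseteq> fam" "\<alpha> = \<Union>\<C>" by blast
    have "g x \<in> C" if g: "g \<in> rotations P" and C: "C \<in> fam" and x: "x \<in> C" for g x C
    proof -
      consider "C = V" | "C = F" | "C = E" | X where "C = B X" "X \<in> riemann_sphere"
        using C unfolding fam_def by blast
      then show ?thesis
      proof cases
        case 4
        with x obtain h where h: "h \<in> rotations P" "x = h X" using B[OF 4(2)] by blast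
        then have "g x = (g \<circ> h) X" "g \<circ> h \<in> rotations P" using rotations_comp g by auto
        then have "g x \<in> (\<lambda>g. g X) ` rotations P" by blast
        then show ?thesis unfolding 4(1) B[OF 4(2)] .
      qed (use x rotation_vertices[OF g] rotation_face_points[OF g] rotation_edge_points[OF g] in
          \<open>auto simp: V_def F_def E_def\<close>)
    qed
    then have "g x \<in> \<alpha>" if "g \<in> rotations P" "x \<in> \<alpha>" for g x
      using that \<C> by (metis Union_iff subsetD)
    then show "moebius_stabilizer \<alpha> = G"
      unfolding G_def using invariant_imp_stabilizer_eq[OF P m assms(9,10,11)] by blast
  qed
qed

end
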